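(* Let $\Gamma$ be a finite $L$-regular triangle-free simplicial graph with $n$ vertices, let $N\ge3$ be an integer, and let $(\Gamma,N)$ be the numbered graph with all vertex numbers equal to $N$. Put $K=\lfloor N/2\rfloor$. Let $\mathcal{G}(z)$ be the geodesic growth series of $\mathrm{NGP}(\Gamma,N)$. For $1\le k\le K$ let $\mathcal{G}_k(z)=\sum_{v\in V\Gamma}\Delta_{v^k}(z)$, and for $1\le k,\ell\le K$ let $\mathcal{G}_{\{k,\ell\}}(z)=\sum_{(u,v)}\Delta_{u^k v^\ell}(z)$, the sum over all ordered pairs $(u,v)$ of adjacent vertices; set $\mathcal{G}_{K+1}(z)=0$ and $\mathcal{G}_{\{k,\ell\}}(z)=0$ whenever $k=K+1$ or $\ell=K+1$. Then for all $1\le k,\ell\le K$: \begin{align*} \mathcal{G}(z)&=2z\,\mathcal{G}_1(z)+1,\\ \mathcal{G}_k(z)&=z\big(\mathcal{G}_{k+1}(z)+2\mathcal{G}_{\{1,k\}}(z)+2(n-L-1)\mathcal{G}_1(z)\big)+n,\\ \mathcal{G}_{\{k,\ell\}}(z)&=z\big(\mathcal{G}_{\{k+1,\ell\}}(z)+\mathcal{G}_{\{k,\ell+1\}}(z)+2(L-1)(\mathcal{G}_{\{1,k\}}(z)+\mathcal{G}_{\{1,\ell\}}(z))+2L(n-2L)\mathcal{G}_1(z)\big)+nL. \end{align*}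
   Context: For a numbered graph $(\Gamma,N)$ (finite simplicial graph with a map $N:V\Gamma\to\{2,3,\dots\}$; here $N$ is constant), $\mathrm{NGP}(\Gamma,N)=\langle v\in V\Gamma\mid v^{N(v)}=1,\ uv=vu\text{ for }\{u,v\}\in E\Gamma\rangle$ with standard generating set $S=V\Gamma\cup(V\Gamma)^{-1}$. A word over $S$ is geodesic if no shorter word over $S$ represents the same element; the geodesic growth series is $\sum_m a_m z^m$ with $a_m$ the number of geodesic words of length $m$. $L$-regular means every vertex has exactly $L$ neighbours; triangle-free means no three pairwise adjacent vertices. For a vertex $v$ and $1\le k\le K$, $\Delta_{v^k}(z)=\sum_m c_m z^m$ where $c_m$ is the number of words $x\in S^m$ such that the word $v^k x$ is geodesic; for adjacent $u,v$ and $1\le k,\ell\le K$, $\Delta_{u^kv^\ell}(z)$ is defined likewise using the words $x$ such that $u^kv^\ell x$ is geodesic. *)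

theory Defs
  imports
    "HOL-Algebra.Group"
    "HOL-Computational_Algebra.Formal_Power_Series"
    "Graph_Theory.Pair_Digraph"
begin

section \<open>Groups given by generators and relations\<close>

text \<open>
  A word in the generators \<open>X\<close> and their formal inverses; \<open>(x, True)\<close> stands for \<open>x\<close> and
  \<open>(x, False)\<close> for its formal inverse.
\<close>

type_synonym 'a gword = "('a \<times> bool) list"

abbreviation gwords :: "'a set \<Rightarrow> 'a gword set" where
  "gwords X \<equiv> lists (X \<times> UNIV)"

text \<open>
  The congruence on words generated by free cancellation and the relations \<open>R\<close>, where a pair
  \<open>(r, s)\<close> stands for the relation \<open>r = s\<close>.
\<close>

inductive pres_eq :: "'a set \<Rightarrow> ('a gword \<times> 'a gword) set \<Rightarrow> 'a gword \<Rightarrow> 'a gword \<Rightarrow> bool"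
  for X :: "'a set" and R :: "('a gword \<times> 'a gword) set" where
  pres_refl: "w \<in> gwords X \<Longrightarrow> pres_eq X R w w"
| pres_sym: "pres_eq X R v w \<Longrightarrow> pres_eq X R w v"
| pres_trans: "pres_eq X R u v \<Longrightarrow> pres_eq X R v w \<Longrightarrow> pres_eq X R u w"
| pres_append: "pres_eq X R u u' \<Longrightarrow> pres_eq X R v v' \<Longrightarrow> pres_eq X R (u @ v) (u' @ v')"
| pres_cancel: "x \<in> X \<Longrightarrow> pres_eq X R [(x, b), (x, \<not> b)] []"
| pres_rel: "(r, s) \<in> R \<Longrightarrow> r \<in> gwords X \<Longrightarrow> s \<in> gwords X \<Longrightarrow> pres_eq X R r s"

definition pres_class :: "'a set \<Rightarrow> ('a gword \<times> 'a gword) set \<Rightarrow> 'a gword \<Rightarrow> 'a gword set" where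
  "pres_class X R w = {w'. pres_eq X R w w'}"

definition pres_group :: "'a set \<Rightarrow> ('a gword \<times> 'a gword) set \<Rightarrow> 'a gword set monoid" where
  "pres_group X R =
     \<lparr> carrier = pres_class X R ` gwords X,
       monoid.mult = (\<lambda>A B. {w. \<exists>a\<in>A. \<exists>b\<in>B. pres_eq X R (a @ b) w}),
       one = pres_class X R [] \<rparr>"

lemma pres_eq_gwords: "pres_eq X R u v \<Longrightarrow> u \<in> gwords X \<and> v \<in> gwords X"
  by (induction rule: pres_eq.induct) auto

lemma pres_class_eq_iff:
  assumes "u \<in> gwords X"
  shows "pres_class X R u = pres_class X R v \<longleftrightarrow> pres_eq X R u v"
proof
  assume "pres_class X R u = pres_class X R v"
  then have "pres_eq X R v u" using pres_refl[OF assms, of R] by (auto simp: pres_class_def)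
  then show "pres_eq X R u v" by (rule pres_sym)
next
  assume uv: "pres_eq X R u v"
  then show "pres_class X R u = pres_class X R v"
    using pres_trans[OF uv] pres_trans[OF pres_sym[OF uv]] by (auto simp: pres_class_def)
qed

lemma pres_mult:
  assumes "u \<in> gwords X" "v \<in> gwords X"
  shows "pres_class X R u \<otimes>\<^bsub>pres_group X R\<^esub> pres_class X R v = pres_class X R (u @ v)"
proof -
  have "pres_eq X R (u @ v) w \<longleftrightarrow>
      (\<exists>a. pres_eq X R u a \<and> (\<exists>b. pres_eq X R v b \<and> pres_eq X R (a @ b) w))" (is "?l \<longleftrightarrow> ?r") for w
  proof
    show ?r if ?l using that pres_refl[OF assms(1)] pres_refl[OF assms(2)] by blast
  next
    assume ?r
    then obtain a b where "pres_eq X R u a" "pres_eq X R v b" and w: "pres_eq X R (a @ b) w"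
      by blast
    then have "pres_eq X R (u @ v) (a @ b)" by (intro pres_append)
    from this w show ?l by (rule pres_trans)
  qed
  then show ?thesis
    by (simp add: pres_group_def pres_class_def)
qed

lemma pres_inverse_word:
  assumes "u \<in> gwords X"
  shows "\<exists>v \<in> gwords X. pres_eq X R (v @ u) []"
  using assms
proof (induction u)
  case Nil
  have "pres_eq X R ([] @ []) []" by (simp add: pres_refl)
  then show ?case by blast
next
  case (Cons a u)
  obtain x b where a: "a = (x, b)" by (cases a)
  with Cons have x: "x \<in> X" by simp
  from Cons obtain v where v: "v \<in> gwords X" "pres_eq X R (v @ u) []" by blast
  have u: "u \<in> gwords X" by fact
  have "pres_eq X R [(x, \<not> b), (x, b)] []"
    using pres_cancel[OF x, of R "\<not> b"] by simp
  then have "pres_eq X R (v @ ([(x, \<not> b), (x, b)] @ u)) (v @ ([] @ u))"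
    by (intro pres_append pres_refl u v(1))
  then have "pres_eq X R ((v @ [(x, \<not> b)]) @ (a # u)) (v @ u)" by (simp add: a)
  then have "pres_eq X R ((v @ [(x, \<not> b)]) @ (a # u)) []" using v(2) by (rule pres_trans)
  moreover have "v @ [(x, \<not> b)] \<in> gwords X"
    using v(1) x by (simp only: append_in_lists_conv) simp
  ultimately show ?case by blast
qed

lemma group_pres_group: "group (pres_group X R)"
proof (rule groupI)
  let ?G = "pres_group X R" and ?c = "pres_class X R"
  have carr: "carrier ?G = ?c ` gwords X" and one: "\<one>\<^bsub>?G\<^esub> = ?c []"
    by (simp_all add: pres_group_def)
  have app: "u @ v \<in> gwords X" if "u \<in> gwords X" "v \<in> gwords X" for u v
    using that by (simp only: append_in_lists_conv)
  show "\<one>\<^bsub>?G\<^esub> \<in> carrier ?G" unfolding carr one by (rule imageI) simp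
  fix x assume "x \<in> carrier ?G"
  then obtain u where u: "u \<in> gwords X" "x = ?c u" unfolding carr by blast
  show "\<one>\<^bsub>?G\<^esub> \<otimes>\<^bsub>?G\<^esub> x = x"
    unfolding one u(2) by (subst pres_mult[OF _ u(1)]) simp_all
  show "\<exists>y\<in>carrier ?G. y \<otimes>\<^bsub>?G\<^esub> x = \<one>\<^bsub>?G\<^esub>"
  proof -
    from pres_inverse_word[OF u(1), of R] obtain v
      where v: "v \<in> gwords X" "pres_eq X R (v @ u) []" by blast
    have "?c v \<otimes>\<^bsub>?G\<^esub> x = \<one>\<^bsub>?G\<^esub>"
      unfolding u(2) one pres_mult[OF v(1) u(1)] pres_class_eq_iff[OF app[OF v(1) u(1)]] by fact
    with v(1) show ?thesis unfolding carr by blast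
  qed
  fix y assume "y \<in> carrier ?G"
  then obtain v where v: "v \<in> gwords X" "y = ?c v" unfolding carr by blast
  show "x \<otimes>\<^bsub>?G\<^esub> y \<in> carrier ?G"
    unfolding u(2) v(2) pres_mult[OF u(1) v(1)] carr by (intro imageI app u v)
  fix z assume "z \<in> carrier ?G"
  then obtain w where w: "w \<in> gwords X" "z = ?c w" unfolding carr by blast
  show "x \<otimes>\<^bsub>?G\<^esub> y \<otimes>\<^bsub>?G\<^esub> z = x \<otimes>\<^bsub>?G\<^esub> (y \<otimes>\<^bsub>?G\<^esub> z)"
    unfolding u(2) v(2) w(2) pres_mult[OF u(1) v(1)] pres_mult[OF v(1) w(1)]
      pres_mult[OF app[OF u(1) v(1)] w(1)] pres_mult[OF u(1) app[OF v(1) w(1)]] by simp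
qed

section \<open>Geodesics with respect to a generating set\<close>

text \<open>Words over \<open>S\<close> are lists of group elements lying in \<open>S\<close>.\<close>

definition word_val :: "('g, 'b) monoid_scheme \<Rightarrow> 'g list \<Rightarrow> 'g" where
  "word_val G w = foldr (\<otimes>\<^bsub>G\<^esub>) w \<one>\<^bsub>G\<^esub>"

definition geodesic :: "('g, 'b) monoid_scheme \<Rightarrow> 'g set \<Rightarrow> 'g list \<Rightarrow> bool" where
  "geodesic G S w \<longleftrightarrow> w \<in> lists S \<and>
     \<not> (\<exists>w' \<in> lists S. length w' < length w \<and> word_val G w' = word_val G w)"

definition geodesic_growth :: "('g, 'b) monoid_scheme \<Rightarrow> 'g set \<Rightarrow> int fps" where
  "geodesic_growth G S = Abs_fps (\<lambda>m. int (card {w \<in> lists S. length w = m \<and> geodesic G S w}))"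

definition geodesic_cont :: "('g, 'b) monoid_scheme \<Rightarrow> 'g set \<Rightarrow> 'g list \<Rightarrow> int fps" where
  "geodesic_cont G S p =
     Abs_fps (\<lambda>m. int (card {x \<in> lists S. length x = m \<and> geodesic G S (p @ x)}))"

section \<open>Graph products of cyclic groups\<close>

text \<open>
  A finite simplicial graph is a \<^const>\<open>pair_graph\<close>: finite, without loops or multiple edges,
  and with a symmetric arc set, so that \<^term>\<open>parcs \<Gamma>\<close> is the set of ordered pairs of
  adjacent vertices.
\<close>

definition regular_graph :: "'a pair_pre_digraph \<Rightarrow> nat \<Rightarrow> bool" where
  "regular_graph \<Gamma> L \<longleftrightarrow> (\<forall>v \<in> pverts \<Gamma>. card {u. (v, u) \<in> parcs \<Gamma>} = L)"

definition triangle_free :: "'a pair_pre_digraph \<Rightarrow> bool" where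
  "triangle_free \<Gamma> \<longleftrightarrow>
     \<not> (\<exists>u v w. (u, v) \<in> parcs \<Gamma> \<and> (v, w) \<in> parcs \<Gamma> \<and> (u, w) \<in> parcs \<Gamma>)"

definition ngp_rels :: "'a pair_pre_digraph \<Rightarrow> ('a \<Rightarrow> nat) \<Rightarrow> ('a gword \<times> 'a gword) set" where
  "ngp_rels \<Gamma> N =
     {(replicate (N v) (v, True), []) | v. v \<in> pverts \<Gamma>} \<union>
     {([(u, True), (v, True)], [(v, True), (u, True)]) | u v. (u, v) \<in> parcs \<Gamma>}"

definition NGP :: "'a pair_pre_digraph \<Rightarrow> ('a \<Rightarrow> nat) \<Rightarrow> 'a gword set monoid" where
  "NGP \<Gamma> N = pres_group (pverts \<Gamma>) (ngp_rels \<Gamma> N)"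

definition ngp_gen :: "'a pair_pre_digraph \<Rightarrow> ('a \<Rightarrow> nat) \<Rightarrow> 'a \<Rightarrow> 'a gword set" where
  "ngp_gen \<Gamma> N v = pres_class (pverts \<Gamma>) (ngp_rels \<Gamma> N) [(v, True)]"

definition ngp_S :: "'a pair_pre_digraph \<Rightarrow> ('a \<Rightarrow> nat) \<Rightarrow> 'a gword set set" where
  "ngp_S \<Gamma> N =
     ngp_gen \<Gamma> N ` pverts \<Gamma> \<union> (\<lambda>v. inv\<^bsub>NGP \<Gamma> N\<^esub> (ngp_gen \<Gamma> N v)) ` pverts \<Gamma>"

definition ngp_geodesic_growth :: "'a pair_pre_digraph \<Rightarrow> ('a \<Rightarrow> nat) \<Rightarrow> int fps" where
  "ngp_geodesic_growth \<Gamma> N = geodesic_growth (NGP \<Gamma> N) (ngp_S \<Gamma> N)"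

definition Delta1 :: "'a pair_pre_digraph \<Rightarrow> ('a \<Rightarrow> nat) \<Rightarrow> 'a \<Rightarrow> nat \<Rightarrow> int fps" where
  "Delta1 \<Gamma> N v k = geodesic_cont (NGP \<Gamma> N) (ngp_S \<Gamma> N) (replicate k (ngp_gen \<Gamma> N v))"

definition Delta2 ::
    "'a pair_pre_digraph \<Rightarrow> ('a \<Rightarrow> nat) \<Rightarrow> 'a \<Rightarrow> nat \<Rightarrow> 'a \<Rightarrow> nat \<Rightarrow> int fps" where
  "Delta2 \<Gamma> N u k v l = geodesic_cont (NGP \<Gamma> N) (ngp_S \<Gamma> N)
     (replicate k (ngp_gen \<Gamma> N u) @ replicate l (ngp_gen \<Gamma> N v))"

text \<open>
  All vertex numbers are now equal to \<open>N\<close>, and \<open>K = N div 2\<close>.  The series with an exponent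
  equal to \<open>K + 1\<close> are zero by convention.
\<close>

definition G1 :: "'a pair_pre_digraph \<Rightarrow> nat \<Rightarrow> nat \<Rightarrow> int fps" where
  "G1 \<Gamma> N k = (if k = N div 2 + 1 then 0 else (\<Sum>v \<in> pverts \<Gamma>. Delta1 \<Gamma> (\<lambda>_. N) v k))"

definition G2 :: "'a pair_pre_digraph \<Rightarrow> nat \<Rightarrow> nat \<Rightarrow> nat \<Rightarrow> int fps" where
  "G2 \<Gamma> N k l = (if k = N div 2 + 1 \<or> l = N div 2 + 1 then 0
     else (\<Sum>(u, v) \<in> parcs \<Gamma>. Delta2 \<Gamma> (\<lambda>_. N) u k v l))"

lemma group_NGP: "group (NGP \<Gamma> N)"
  unfolding NGP_def by (rule group_pres_group)

lemma (in group) word_val_append: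
  assumes "u \<in> lists (carrier G)" "v \<in> lists (carrier G)"
  shows "word_val G u \<in> carrier G" "word_val G (u @ v) = word_val G u \<otimes> word_val G v"
proof -
  have closed: "word_val G w \<in> carrier G" if "w \<in> lists (carrier G)" for w
    using that by (induction w) (auto simp: word_val_def)
  show "word_val G u \<in> carrier G" by (rule closed) fact
  show "word_val G (u @ v) = word_val G u \<otimes> word_val G v"
    using assms
  proof (induction u)
    case Nil
    then show ?case using closed by (auto simp: word_val_def)
  next
    case (Cons a u)
    then show ?case using closed[of u] closed[of v] by (auto simp: word_val_def m_assoc)
  qed
qed

lemma (in group) word_val_replicate:
  "x \<in> carrier G \<Longrightarrow> word_val G (replicate k x) = x [^] k"
  by (induction k) (simp_all add: word_val_def nat_pow_Suc2[symmetric])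

lemma ngp_gen_closed: "v \<in> pverts \<Gamma> \<Longrightarrow> ngp_gen \<Gamma> N v \<in> carrier (NGP \<Gamma> N)"
  by (auto simp: ngp_gen_def NGP_def pres_group_def)

lemma ngp_gen_commute:
  assumes "pair_graph \<Gamma>" "(u, v) \<in> parcs \<Gamma>"
  shows "ngp_gen \<Gamma> N u \<otimes>\<^bsub>NGP \<Gamma> N\<^esub> ngp_gen \<Gamma> N v = ngp_gen \<Gamma> N v \<otimes>\<^bsub>NGP \<Gamma> N\<^esub> ngp_gen \<Gamma> N u"
proof -
  interpret pair_graph \<Gamma> by fact
  have "u \<in> pverts \<Gamma>" "v \<in> pverts \<Gamma>" using assms(2) by (auto dest: in_arcsD1 in_arcsD2)
  moreover have "([(u, True), (v, True)], [(v, True), (u, True)]) \<in> ngp_rels \<Gamma> N"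
    using assms(2) by (auto simp: ngp_rels_def)
  ultimately show ?thesis
    by (simp add: ngp_gen_def NGP_def pres_mult pres_class_eq_iff pres_rel)
qed

text \<open>
  The symmetry that justifies indexing these series by the unordered pair \<open>{k, l}\<close>.
\<close>

lemma G2_commute:
  assumes "pair_graph \<Gamma>"
  shows "G2 \<Gamma> N k l = G2 \<Gamma> N l k"
proof -
  interpret pair_graph \<Gamma> by fact
  let ?N = "\<lambda>_. N"
  let ?H = "NGP \<Gamma> ?N" and ?g = "ngp_gen \<Gamma> ?N" and ?S = "ngp_S \<Gamma> ?N"
  interpret H: group ?H by (rule group_NGP)
  have S: "?S \<subseteq> carrier ?H" by (auto simp: ngp_S_def ngp_gen_closed)
  have *: "Delta2 \<Gamma> ?N u k v l = Delta2 \<Gamma> ?N v l u k" if uv: "(u, v) \<in> parcs \<Gamma>" for u v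
  proof -
    let ?p = "replicate k (?g u)" and ?q = "replicate l (?g v)"
    have V: "u \<in> pverts \<Gamma>" "v \<in> pverts \<Gamma>" using uv by (auto dest: in_arcsD1 in_arcsD2)
    then have c: "?g u \<in> carrier ?H" "?g v \<in> carrier ?H" by (simp_all add: ngp_gen_closed)
    have pq: "?p \<in> lists (carrier ?H)" "?q \<in> lists (carrier ?H)" using c by auto
    have "?g u [^]\<^bsub>?H\<^esub> k \<otimes>\<^bsub>?H\<^esub> ?g v [^]\<^bsub>?H\<^esub> l = ?g v [^]\<^bsub>?H\<^esub> l \<otimes>\<^bsub>?H\<^esub> ?g u [^]\<^bsub>?H\<^esub> k"
      by (intro H.group_commutes_pow H.nat_pow_closed c
        H.group_commutes_pow[OF ngp_gen_commute[OF assms uv, symmetric] c(2,1), symmetric])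
    then have val: "word_val ?H (?p @ ?q) = word_val ?H (?q @ ?p)"
      using pq c by (simp add: H.word_val_append H.word_val_replicate)
    have "geodesic ?H ?S ((?p @ ?q) @ x) \<longleftrightarrow> geodesic ?H ?S ((?q @ ?p) @ x)"
      if x: "x \<in> lists ?S" for x
    proof -
      have "x \<in> lists (carrier ?H)" using S x by (meson in_mono lists_mono)
      then have "word_val ?H ((?p @ ?q) @ x) = word_val ?H ((?q @ ?p) @ x)"
        using H.word_val_append(2)[of "?p @ ?q" x] H.word_val_append(2)[of "?q @ ?p" x] pq val
        by (simp del: append_assoc)
      moreover have "(?p @ ?q) @ x \<in> lists ?S \<longleftrightarrow> (?q @ ?p) @ x \<in> lists ?S"
        by (simp only: append_in_lists_conv conj_ac)
      moreover have "length ((?p @ ?q) @ x) = length ((?q @ ?p) @ x)" by simp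
      ultimately show ?thesis by (simp only: geodesic_def)
    qed
    then show ?thesis by (auto simp: Delta2_def geodesic_cont_def cong: conj_cong)
  qed
  have sym: "(v, u) \<in> parcs \<Gamma>" if "(u, v) \<in> parcs \<Gamma>" for u v
    using that pair_sym_arcs unfolding symmetric_def with_proj_simps by (rule symD[rotated])
  have "(\<Sum>(u, v) \<in> parcs \<Gamma>. Delta2 \<Gamma> ?N u k v l) = (\<Sum>(u, v) \<in> parcs \<Gamma>. Delta2 \<Gamma> ?N u l v k)"
    by (rule sum.reindex_bij_witness[of _ prod.swap prod.swap]) (auto intro: sym *[symmetric])
  then show ?thesis by (auto simp: G2_def)
qed

end

theory Submission
  imports Defs
begin

text \<open>
  The group acts on piles of syllables: above every vertex \<open>x\<close> stands a stack whose entries are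
  nonzero exponents of \<open>x\<close>, interspersed with a marker for every syllable of a vertex that does
  not commute with \<open>x\<close>.  Two syllables of the same vertex can merge precisely when no marker
  separates them.  The sum of the distances of the exponents from \<open>0\<close> in the cycle of length \<open>N\<close>
  is the word length of the group element that built the pile, so a word is geodesic iff its
  length equals the size of its pile.

  If \<open>w x\<close> is geodesic then the syllable of \<open>w\<close> lies on top of the pile, hence every stack of
  another vertex not adjacent to \<open>w\<close> has a marker on top, and prepending \<open>v\<^sup>k\<close> for such a vertex \<open>v\<close> keeps
  the word geodesic.  Therefore only the syllables that commute with the next letter of a geodesic
  matter; reading off the next letter gives the three equations.
\<close>

section \<open>Powers of the generators\<close>

locale const_ngp =
  fixes \<Gamma> :: "'a pair_pre_digraph" and N :: nat
  assumes pair_graph: "pair_graph \<Gamma>" and N_ge3: "N \<ge> 3"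
begin

abbreviation V where "V \<equiv> pverts \<Gamma>"
abbreviation E where "E \<equiv> parcs \<Gamma>"
abbreviation H where "H \<equiv> NGP \<Gamma> (\<lambda>_. N)"
abbreviation gen where "gen \<equiv> ngp_gen \<Gamma> (\<lambda>_. N)"
abbreviation cls where "cls \<equiv> pres_class V (ngp_rels \<Gamma> (\<lambda>_. N))"

sublocale H: group H
  by (rule group_NGP)

lemma finite_V: "finite V" and finite_E: "finite E"
proof -
  interpret pair_graph \<Gamma> by (rule pair_graph)
  show "finite V" "finite E" by (rule pair_finite_verts pair_finite_arcs)+
qed

lemma E_V: "(u, v) \<in> E \<Longrightarrow> u \<in> V \<and> v \<in> V"
  and E_neq: "(u, v) \<in> E \<Longrightarrow> u \<noteq> v"
  and E_sym: "(u, v) \<in> E \<Longrightarrow> (v, u) \<in> E"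
proof -
  interpret pair_graph \<Gamma> by (rule pair_graph)
  show "(u, v) \<in> E \<Longrightarrow> u \<in> V \<and> v \<in> V" by (auto dest: in_arcsD1 in_arcsD2)
  show "(u, v) \<in> E \<Longrightarrow> u \<noteq> v" by (rule no_loops')
  show "(u, v) \<in> E \<Longrightarrow> (v, u) \<in> E"
    using pair_sym_arcs unfolding symmetric_def with_proj_simps by (rule symD)
qed

lemma E_loop [simp]: "(v, v) \<notin> E"
  using E_neq by blast

lemma cls_carrier: "w \<in> gwords V \<Longrightarrow> cls w \<in> carrier H"
  by (auto simp: NGP_def pres_group_def)

lemma cls_Nil: "cls [] = \<one>\<^bsub>H\<^esub>"
  by (simp add: NGP_def pres_group_def)

lemma cls_append:
  assumes "w \<in> gwords V" "w' \<in> gwords V"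
  shows "cls (w @ w') = cls w \<otimes>\<^bsub>H\<^esub> cls w'"
  using pres_mult[OF assms] by (simp add: NGP_def)

lemma gen_closed: "v \<in> V \<Longrightarrow> gen v \<in> carrier H"
  by (rule ngp_gen_closed)

lemma inv_gen: "v \<in> V \<Longrightarrow> inv\<^bsub>H\<^esub> gen v = cls [(v, False)]"
proof -
  assume v: "v \<in> V"
  have "cls [(v, False)] \<otimes>\<^bsub>H\<^esub> gen v = cls [(v, False), (v, True)]"
    using cls_append[of "[(v, False)]" "[(v, True)]"] v by (simp add: ngp_gen_def)
  also have "\<dots> = \<one>\<^bsub>H\<^esub>"
    using pres_cancel[OF v, of _ False] v by (simp add: cls_Nil[symmetric] pres_class_eq_iff)
  finally show ?thesis
    using H.inv_equality v cls_carrier[of "[(v, False)]"] gen_closed[OF v] by simp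
qed

definition lexp :: "bool \<Rightarrow> int" where
  "lexp b = (if b then 1 else -1)"

lemma cls_letter: "v \<in> V \<Longrightarrow> cls [(v, b)] = gen v [^]\<^bsub>H\<^esub> lexp b"
  using gen_closed[of v] inv_gen[of v]
  by (cases b) (simp_all add: lexp_def ngp_gen_def H.int_pow_neg)

lemma gwords_replicate [simp]: "v \<in> V \<Longrightarrow> replicate k (v, b) \<in> gwords V"
  by (auto simp: in_lists_conv_set)

lemma cls_replicate: "v \<in> V \<Longrightarrow> cls (replicate k (v, True)) = gen v [^]\<^bsub>H\<^esub> k"
proof (induction k)
  case (Suc k)
  have "cls (replicate (Suc k) (v, True)) = cls [(v, True)] \<otimes>\<^bsub>H\<^esub> cls (replicate k (v, True))"
    using cls_append[of "[(v, True)]" "replicate k (v, True)"] Suc gwords_replicate[of v k True]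
    by simp
  then show ?case
    using Suc gen_closed[of v] H.nat_pow_Suc2[of "gen v" k] by (simp add: ngp_gen_def)
qed (simp add: cls_Nil)

lemma cls_replicate_False: "v \<in> V \<Longrightarrow> cls (replicate k (v, False)) = gen v [^]\<^bsub>H\<^esub> (- int k)"
proof (induction k)
  case (Suc k)
  have "cls (replicate (Suc k) (v, False)) = cls [(v, False)] \<otimes>\<^bsub>H\<^esub> cls (replicate k (v, False))"
    using cls_append[of "[(v, False)]" "replicate k (v, False)"] Suc gwords_replicate[of v k False]
    by simp
  also have "\<dots> = gen v [^]\<^bsub>H\<^esub> (-1 + - int k)"
    using Suc gen_closed[of v] by (simp add: cls_letter lexp_def flip: H.int_pow_mult)
  finally show ?case by (simp add: algebra_simps)
qed (simp add: cls_Nil)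

lemma gen_pow_N: "v \<in> V \<Longrightarrow> gen v [^]\<^bsub>H\<^esub> N = \<one>\<^bsub>H\<^esub>"
proof -
  assume v: "v \<in> V"
  have "pres_eq V (ngp_rels \<Gamma> (\<lambda>_. N)) (replicate N (v, True)) []"
    using v by (intro pres_rel) (auto simp: ngp_rels_def)
  then show ?thesis
    using v by (simp add: cls_replicate[symmetric] cls_Nil[symmetric] pres_class_eq_iff)
qed

lemma gen_pow_mod: "v \<in> V \<Longrightarrow> gen v [^]\<^bsub>H\<^esub> (e mod int N) = gen v [^]\<^bsub>H\<^esub> e"
proof -
  assume v: "v \<in> V"
  have "gen v [^]\<^bsub>H\<^esub> e = gen v [^]\<^bsub>H\<^esub> (int N * (e div int N) + e mod int N)" by simp
  also have "\<dots> = (gen v [^]\<^bsub>H\<^esub> int N) [^]\<^bsub>H\<^esub> (e div int N) \<otimes>\<^bsub>H\<^esub> gen v [^]\<^bsub>H\<^esub> (e mod int N)"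
    using gen_closed[OF v] by (simp only: H.int_pow_mult H.int_pow_pow)
  also have "\<dots> = gen v [^]\<^bsub>H\<^esub> (e mod int N)"
    using gen_closed[OF v] gen_pow_N[OF v] by (simp add: int_pow_int)
  finally show ?thesis by simp
qed

lemma gen_pow_commute:
  assumes "(u, v) \<in> E"
  shows "gen u [^]\<^bsub>H\<^esub> (i::int) \<otimes>\<^bsub>H\<^esub> gen v [^]\<^bsub>H\<^esub> (j::int) = gen v [^]\<^bsub>H\<^esub> j \<otimes>\<^bsub>H\<^esub> gen u [^]\<^bsub>H\<^esub> i"
proof -
  have c: "gen u \<in> carrier H" "gen v \<in> carrier H" using E_V[OF assms] gen_closed by auto
  have nat: "gen u [^]\<^bsub>H\<^esub> i' \<otimes>\<^bsub>H\<^esub> gen v [^]\<^bsub>H\<^esub> j' = gen v [^]\<^bsub>H\<^esub> j' \<otimes>\<^bsub>H\<^esub> gen u [^]\<^bsub>H\<^esub> i'"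
    for i' j' :: nat
    by (intro H.group_commutes_pow H.nat_pow_closed c
        H.group_commutes_pow[OF ngp_gen_commute[OF pair_graph assms, symmetric] c(2,1), symmetric])
  \<comment> \<open>Reduced modulo \<open>N\<close> the exponents are nonnegative, so commutation of
    natural powers covers all integer powers.\<close>
  have "i mod int N = int (nat (i mod int N))" "j mod int N = int (nat (j mod int N))"
    using N_ge3 by simp_all
  then show ?thesis
    using nat[of "nat (i mod int N)" "nat (j mod int N)"]
      gen_pow_mod[of u i] gen_pow_mod[of v j] E_V[OF assms] by (metis int_pow_int)
qed

section \<open>Piles of syllables\<close>

text \<open>
  The entry \<open>0\<close> is the marker.  An empty stack also has top entry \<open>0\<close>, since both mean that no
  syllable of the vertex can be moved to the front.
\<close>

definition top :: "('a \<Rightarrow> int list) \<Rightarrow> 'a \<Rightarrow> int" where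
  "top s v = (case s v of [] \<Rightarrow> 0 | e # _ \<Rightarrow> e)"

text \<open>A syllable whose exponent becomes \<open>0\<close> disappears, so it must not leave
  markers behind; hence the guard.\<close>

definition push :: "'a \<Rightarrow> int \<Rightarrow> ('a \<Rightarrow> int list) \<Rightarrow> 'a \<Rightarrow> int list" where
  "push v e s = (if e = 0 then s else
     (\<lambda>x. if x = v then e # s x else if (v, x) \<in> E then s x else 0 # s x))"

text \<open>Removes the movable syllable of \<open>v\<close> together with the markers it left.
  Taking \<open>tl\<close> is right on reachable piles, where the stacks of all other vertices not
  adjacent to \<open>v\<close> then have such a marker on top.\<close>

definition pop :: "'a \<Rightarrow> ('a \<Rightarrow> int list) \<Rightarrow> 'a \<Rightarrow> int list" where
  "pop v s = (if top s v = 0 then s else (\<lambda>x. if (v, x) \<in> E then s x else tl (s x)))"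

text \<open>Left multiplication by the power \<open>v^d\<close>: the movable syllable of
  \<open>v\<close> absorbs \<open>d\<close> and vanishes if the total exponent is divisible by
  \<open>N\<close>.\<close>

definition act :: "'a \<Rightarrow> int \<Rightarrow> ('a \<Rightarrow> int list) \<Rightarrow> 'a \<Rightarrow> int list" where
  "act v d s = push v ((top s v + d) mod int N) (pop v s)"

text \<open>The word length of \<open>e\<close> in the cyclic group of order \<open>N\<close> with
  generators \<open>1\<close> and \<open>-1\<close>.\<close>

definition weight :: "int \<Rightarrow> int" where
  "weight e = min (e mod int N) ((- e) mod int N)"

definition len :: "('a \<Rightarrow> int list) \<Rightarrow> int" where
  "len s = (\<Sum>x\<in>V. sum_list (map weight (s x)))"

text \<open>
  Carrying the group element along with the pile shows, without a normal form theorem, that every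
  element has a representative of the length recorded by its pile.
\<close>

inductive reach :: "('a \<Rightarrow> int list) \<Rightarrow> 'a gword set \<Rightarrow> bool" where
  reach_empty: "reach (\<lambda>_. []) \<one>\<^bsub>H\<^esub>"
| reach_push: "reach s h \<Longrightarrow> v \<in> V \<Longrightarrow> top s v = 0 \<Longrightarrow> 0 \<le> e \<Longrightarrow> e < int N \<Longrightarrow>
    reach (push v e s) (gen v [^]\<^bsub>H\<^esub> e \<otimes>\<^bsub>H\<^esub> h)"

definition valid :: "('a \<Rightarrow> int list) \<Rightarrow> bool" where
  "valid s \<longleftrightarrow> (\<exists>h. reach s h)"

lemma push_0 [simp]: "push v 0 s = s"
  by (simp add: push_def)

lemma top_push_same: "top s v = 0 \<Longrightarrow> top (push v e s) v = e"
  by (simp add: top_def push_def)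

lemma top_push_adj: "(v, u) \<in> E \<Longrightarrow> top (push v e s) u = top s u"
  using E_neq[of v u] by (auto simp: top_def push_def)

lemma top_push_nonadj: "e \<noteq> 0 \<Longrightarrow> u \<noteq> v \<Longrightarrow> (v, u) \<notin> E \<Longrightarrow> top (push v e s) u = 0"
  by (simp add: top_def push_def)

lemma pop_push: "top s v = 0 \<Longrightarrow> pop v (push v e s) = s"
  by (auto simp: pop_def top_push_same) (auto simp: push_def)

lemma act_push: "top s v = 0 \<Longrightarrow> act v d (push v e s) = push v ((e + d) mod int N) s"
  by (simp add: act_def top_push_same pop_push)

lemma push_commute: "(u, v) \<in> E \<Longrightarrow> push u e (push v f s) = push v f (push u e s)"
  using E_neq[of u v] E_sym[of u v] by (auto simp: push_def fun_eq_iff)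

lemma weight_0 [simp]: "weight 0 = 0"
  by (simp add: weight_def)

lemma weight_mod [simp]: "weight (e mod int N) = weight e"
  by (simp add: weight_def mod_minus_eq)

lemma weight_uminus [simp]: "weight (- e) = weight e"
  by (simp add: weight_def min.commute)

lemma len_push: "v \<in> V \<Longrightarrow> len (push v e s) = weight e + len s"
proof -
  assume v: "v \<in> V"
  have "len (push v e s) = (\<Sum>x\<in>V. (if x = v then weight e else 0) + sum_list (map weight (s x)))"
    unfolding len_def push_def by (intro sum.cong) auto
  then show ?thesis
    using v finite_V by (simp add: sum.distrib len_def)
qed

lemma reach_carrier: "reach s h \<Longrightarrow> h \<in> carrier H"
  by (induction rule: reach.induct) (auto simp: gen_closed)

text \<open>Any movable syllable can be lifted to the top of the pile without changing the group
  element. By induction, the last syllable pushed is trivial, belongs to \<open>v\<close>, blocks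
  \<open>v\<close>, or commutes with \<open>v\<close>.\<close>

lemma reach_decompose:
  assumes "reach s h" "v \<in> V"
  shows "\<exists>s' h'. reach s' h' \<and> top s' v = 0 \<and> s = push v (top s v) s' \<and>
    h = gen v [^]\<^bsub>H\<^esub> top s v \<otimes>\<^bsub>H\<^esub> h' \<and> 0 \<le> top s v \<and> top s v < int N"
  using assms
proof (induction rule: reach.induct)
  case reach_empty
  have "top (\<lambda>_. []) v = 0" by (simp add: top_def)
  then show ?case
    using N_ge3 by (intro exI[of _ "\<lambda>_. []"] exI[of _ "\<one>\<^bsub>H\<^esub>"]) (auto intro: reach.reach_empty)
next
  case (reach_push s h u e)
  let ?g = "gen u [^]\<^bsub>H\<^esub> e \<otimes>\<^bsub>H\<^esub> h"
  consider "e = 0" | "u = v" | "e \<noteq> 0" "u \<noteq> v" "(u, v) \<notin> E" | "(u, v) \<in> E" by blast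
  then show ?case
  proof cases
    case 1
    then show ?thesis using reach_push reach_carrier by auto
  next
    case 2
    then show ?thesis using reach_push by (auto simp: top_push_same)
  next
    case 3
    then have t: "top (push u e s) v = 0" by (simp add: top_push_nonadj)
    have "reach (push u e s) ?g" using reach_push by (intro reach.reach_push) auto
    moreover from reach_carrier[OF this] have "?g = gen v [^]\<^bsub>H\<^esub> (0::int) \<otimes>\<^bsub>H\<^esub> ?g" by simp
    ultimately show ?thesis using t N_ge3 by fastforce
  next
    \<comment> \<open>The syllable of \<open>v\<close> lies below that of \<open>u\<close>, but the
      two commute both in the pile and in the group.\<close>
    case 4
    from reach_push obtain s' h' where s': "reach s' h'" "top s' v = 0" "s = push v (top s v) s'"
      "h = gen v [^]\<^bsub>H\<^esub> top s v \<otimes>\<^bsub>H\<^esub> h'" "0 \<le> top s v" "top s v < int N" by blast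
    have t: "top (push u e s) v = top s v" "top (push u e s') v = 0" "top s' u = 0"
      using 4 E_sym[OF 4] s'(2) reach_push(3) s'(3) by (metis top_push_adj)+
    have "reach (push u e s') (gen u [^]\<^bsub>H\<^esub> e \<otimes>\<^bsub>H\<^esub> h')"
      using reach_push(2,4,5) t(3) s'(1) E_V[OF 4] by (intro reach.reach_push) auto
    moreover have "push u e s = push v (top s v) (push u e s')"
      using s'(3) push_commute[OF 4] by metis
    moreover have "?g = gen v [^]\<^bsub>H\<^esub> top s v \<otimes>\<^bsub>H\<^esub> (gen u [^]\<^bsub>H\<^esub> e \<otimes>\<^bsub>H\<^esub> h')"
    proof -
      have "gen u \<in> carrier H" "gen v \<in> carrier H" "h' \<in> carrier H"
        using E_V[OF 4] gen_closed reach_carrier[OF s'(1)] by auto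
      then show ?thesis
        unfolding s'(4) using gen_pow_commute[OF 4, of e "top s v"] by (simp flip: H.m_assoc)
    qed
    ultimately show ?thesis using t s' by metis
  qed
qed

lemma valid_decompose:
  assumes "valid s" "v \<in> V"
  obtains s' where "valid s'" "top s' v = 0" "s = push v (top s v) s'"
    "0 \<le> top s v" "top s v < int N"
  using assms reach_decompose unfolding valid_def by blast

lemma valid_empty: "valid (\<lambda>_. [])"
  using reach_empty by (auto simp: valid_def)

lemma valid_push: "valid s \<Longrightarrow> v \<in> V \<Longrightarrow> top s v = 0 \<Longrightarrow> valid (push v (e mod int N) s)"
  using N_ge3 reach_push[of s _ v "e mod int N"] by (auto simp: valid_def)

lemma valid_act:
  assumes "valid s" "v \<in> V"
  shows "valid (act v d s)"
proof -
  obtain s' where s': "valid s'" "top s' v = 0" "s = push v (top s v) s'"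
    using valid_decompose[OF assms] by metis
  show ?thesis by (subst s'(3)) (simp add: act_push s'(1,2) valid_push assms)
qed

text \<open>Only the exponent of the lifted syllable changes, and reducing it modulo
  \<open>N\<close> does not affect the group element.\<close>

lemma reach_act:
  assumes "reach s h" "v \<in> V"
  shows "reach (act v d s) (gen v [^]\<^bsub>H\<^esub> d \<otimes>\<^bsub>H\<^esub> h)"
proof -
  obtain s' h' where s': "reach s' h'" "top s' v = 0" "s = push v (top s v) s'"
    "h = gen v [^]\<^bsub>H\<^esub> top s v \<otimes>\<^bsub>H\<^esub> h'"
    using reach_decompose[OF assms] by metis
  define t where "t = top s v"
  have c: "gen v \<in> carrier H" "h' \<in> carrier H" using gen_closed assms reach_carrier s' by auto
  have "reach (push v ((t + d) mod int N) s') (gen v [^]\<^bsub>H\<^esub> ((t + d) mod int N) \<otimes>\<^bsub>H\<^esub> h')"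
    using s'(1,2) assms N_ge3 by (intro reach_push) auto
  moreover have "gen v [^]\<^bsub>H\<^esub> ((t + d) mod int N) \<otimes>\<^bsub>H\<^esub> h' = gen v [^]\<^bsub>H\<^esub> d \<otimes>\<^bsub>H\<^esub> h"
    unfolding gen_pow_mod[OF assms(2)] s'(4) t_def[symmetric] using c
    by (subst add.commute) (simp add: H.int_pow_mult H.m_assoc)
  moreover have "act v d s = push v ((t + d) mod int N) s'"
    using s' act_push unfolding t_def by metis
  ultimately show ?thesis by simp
qed

lemma top_act: "valid s \<Longrightarrow> v \<in> V \<Longrightarrow> top (act v d s) v = (top s v + d) mod int N"
  by (metis act_push top_push_same valid_decompose)

lemma top_act_adj:
  assumes "valid s" "(v, u) \<in> E"
  shows "top (act v d s) u = top s u"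
  by (metis act_push top_push_adj valid_decompose assms E_V)

text \<open>Lifting the nontrivial syllable of \<open>v\<close> to the top exposes its marker on the
  stack of \<open>u\<close>.\<close>

lemma top_nonadj:
  assumes "valid s" "v \<in> V" "top s v \<noteq> 0" "u \<noteq> v" "(v, u) \<notin> E"
  shows "top s u = 0"
  by (metis valid_decompose top_push_nonadj assms)

section \<open>The defining relations hold for the action on piles\<close>

lemma act_add:
  assumes "valid s" "v \<in> V"
  shows "act v d (act v d' s) = act v (d' + d) s"
proof -
  obtain s' where s': "top s' v = 0" "s = push v (top s v) s'"
    using valid_decompose[OF assms] by metis
  show ?thesis
    by (subst (1 2) s'(2)) (simp add: act_push s'(1) mod_add_left_eq add.assoc)
qed

lemma act_dvd:
  assumes "valid s" "v \<in> V" "int N dvd d"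
  shows "act v d s = s"
proof -
  obtain s' where s': "top s' v = 0" "s = push v (top s v) s'" "0 \<le> top s v" "top s v < int N"
    using valid_decompose[OF assms(1,2)] by metis
  have "(top s v + d) mod int N = top s v"
    using s'(3,4) assms(3) by (metis add_0_right dvd_imp_mod_0 mod_add_right_eq mod_pos_pos_trivial)
  then show ?thesis using s' act_push by metis
qed

text \<open>Neither syllable leaves a marker on the stack of the other vertex, so both can be lifted
  to the top in either order, and each action changes its own exponent only.\<close>

lemma act_commute:
  assumes "valid s" "(u, v) \<in> E"
  shows "act u d (act v d' s) = act v d' (act u d s)"
proof -
  obtain s1 where s1: "valid s1" "top s1 v = 0" "s = push v (top s v) s1"
    using valid_decompose E_V assms by metis
  obtain s2 where s2: "valid s2" "top s2 u = 0" "s1 = push u (top s1 u) s2"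
    using valid_decompose E_V assms s1(1) by metis
  have t: "top (push v i s2) u = 0" "top s2 v = 0" "top (push u i s2) v = 0" for i
    using s2 s1 assms(2) E_sym[OF assms(2)] by (metis top_push_adj)+
  have "act v d' (push v e (push u f s2)) = push v ((e + d') mod int N) (push u f s2)" for d' e f
    by (simp add: act_push t)
  moreover have "act u d (push v e (push u f s2)) = push v e (push u ((f + d) mod int N) s2)"
    for d e f
    using act_push[OF t(1)] push_commute[OF assms(2)] by metis
  moreover obtain e f where "s = push v e (push u f s2)" using s1 s2 by metis
  ultimately show ?thesis by simp
qed

lemma len_act:
  assumes "valid s" "v \<in> V"
  shows "len (act v d s) = len s + weight (top s v + d) - weight (top s v)"
proof -
  obtain s' where s': "top s' v = 0" "s = push v (top s v) s'"
    using valid_decompose[OF assms] by metis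
  then have "len s = weight (top s v) + len s'" using len_push[OF assms(2)] by metis
  moreover have "len (act v d s) = weight (top s v + d) + len s'"
    by (subst s'(2)) (simp add: act_push s'(1) len_push assms(2))
  ultimately show ?thesis by simp
qed

section \<open>Geodesic words\<close>

text \<open>The rightmost letter acts first, so prepending letters corresponds to left
  multiplication.\<close>

definition run :: "'a gword \<Rightarrow> ('a \<Rightarrow> int list) \<Rightarrow> 'a \<Rightarrow> int list" where
  "run w = foldr (\<lambda>(v, b). act v (lexp b)) w"

abbreviation pile where "pile w \<equiv> run w (\<lambda>_. [])"

lemma run_Nil [simp]: "run [] s = s"
  and run_Cons [simp]: "run ((v, b) # w) s = act v (lexp b) (run w s)"
  and run_append [simp]: "run (w @ w') s = run w (run w' s)"
  by (simp_all add: run_def)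

lemma valid_run: "valid s \<Longrightarrow> w \<in> gwords V \<Longrightarrow> valid (run w s)"
  by (induction w) (auto simp: valid_act)

lemma run_replicate: "valid s \<Longrightarrow> v \<in> V \<Longrightarrow> run (replicate k (v, True)) s = act v (int k) s"
  by (induction k) (simp_all add: act_dvd act_add lexp_def add.commute)

text \<open>Free cancellation and the relations act trivially on valid piles; hence the pile of a
  word depends only on the group element it represents.\<close>

lemma run_cong:
  assumes "pres_eq V (ngp_rels \<Gamma> (\<lambda>_. N)) w w'" "valid s"
  shows "run w s = run w' s"
  using assms
proof (induction arbitrary: s rule: pres_eq.induct)
  case (pres_append u u' v v')
  have "valid (run v' s)"
    using pres_eq_gwords[OF pres_append.hyps(2)] valid_run[OF pres_append.prems] by simp
  then show ?case using pres_append.IH pres_append.prems by simp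
next
  case (pres_cancel v b)
  then show ?case by (simp add: act_add act_dvd) (simp add: lexp_def act_dvd)
next
  case (pres_rel w w')
  from pres_rel(1) consider v where "w = replicate N (v, True)" "w' = []" "v \<in> V"
    | u v where "w = [(u, True), (v, True)]" "w' = [(v, True), (u, True)]" "(u, v) \<in> E"
    unfolding ngp_rels_def by blast
  then show ?case
  proof cases
    case 1
    then show ?thesis using pres_rel by (simp add: run_replicate act_dvd)
  next
    case (2 u v)
    then show ?thesis using act_commute pres_rel by simp
  qed
qed auto

lemma reach_run:
  assumes "reach s h" "w \<in> gwords V"
  shows "reach (run w s) (cls w \<otimes>\<^bsub>H\<^esub> h)"
  using assms(2)
proof (induction w)
  case Nil
  then show ?case using assms reach_carrier by (simp add: cls_Nil)
next
  case (Cons a w)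
  obtain v b where a: "a = (v, b)" "v \<in> V" using Cons by (cases a) auto
  have w: "w \<in> gwords V" using Cons by simp
  have "cls (a # w) = cls [a] \<otimes>\<^bsub>H\<^esub> cls w"
    using cls_append[of "[a]" w] a w by simp
  then have "cls (a # w) \<otimes>\<^bsub>H\<^esub> h = cls [a] \<otimes>\<^bsub>H\<^esub> (cls w \<otimes>\<^bsub>H\<^esub> h)"
    using cls_carrier[OF w] cls_carrier[of "[a]"] a reach_carrier[OF assms(1)] by (simp add: H.m_assoc)
  then show ?case
    using reach_act[OF Cons.IH a(2), of "lexp b"] a by (simp add: cls_letter)
qed

section \<open>Word length and the size of piles\<close>

lemma weight_nonneg: "0 \<le> weight e"
  using N_ge3 by (simp add: weight_def)

lemma weight_eq: "0 \<le> e \<Longrightarrow> e < int N \<Longrightarrow> weight e = min e (int N - e)"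
  by (auto simp: weight_def zmod_zminus1_eq_if)

text \<open>Up to \<open>N div 2\<close> the way around the cycle in the negative direction is no
  shorter.\<close>

lemma weight_small: "k \<le> N div 2 \<Longrightarrow> weight (int k) = int k"
  using N_ge3 by (subst weight_eq) auto

text \<open>Neighbours in the cycle differ by at most one in their distance from
  \<open>0\<close>.\<close>

lemma weight_lexp: "weight (e + lexp b) \<le> weight e + 1"
proof -
  define r where "r = e mod int N"
  have r: "0 \<le> r" "r < int N" using N_ge3 by (simp_all add: r_def)
  have "weight (e + lexp b) = weight (r + lexp b)"
    unfolding r_def by (metis mod_add_left_eq weight_mod)
  moreover have "weight e = weight r" by (simp add: r_def)
  moreover have "weight (r + lexp b) \<le> weight r + 1"
  proof -
    \<comment> \<open>Apart from the two wrap-arounds, \<open>r + lexp b\<close> is again a reduced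
      residue.\<close>
    consider "0 \<le> r + lexp b" "r + lexp b < int N" | "r = 0" "b = False" | "r = int N - 1" "b = True"
      using r by (cases b) (fastforce simp: lexp_def)+
    then show ?thesis
    proof cases
      case 1
      then show ?thesis using r by (auto simp: weight_eq lexp_def)
    next
      case 2
      then show ?thesis using N_ge3 weight_eq[of 1] by (simp add: lexp_def weight_def)
    next
      case 3
      then show ?thesis using weight_nonneg[of r] by (simp add: lexp_def weight_def)
    qed
  qed
  ultimately show ?thesis by simp
qed

lemma len_act_le: "valid s \<Longrightarrow> v \<in> V \<Longrightarrow> len (act v (lexp b) s) \<le> len s + 1"
  using len_act[of s v "lexp b"] weight_lexp[of "top s v" b] by simp

lemma len_run_le: "valid s \<Longrightarrow> w \<in> gwords V \<Longrightarrow> len (run w s) \<le> int (length w) + len s"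
proof (induction w)
  case (Cons a w)
  then show ?case using len_act_le[of "run w s" "fst a" "snd a"] valid_run[of s w] by (cases a) auto
qed simp

lemma len_empty [simp]: "len (\<lambda>_. []) = 0"
  by (simp add: len_def)

text \<open>Every syllable is spelled by the shorter of its positive and its negative power, which
  has length \<open>weight e\<close>.\<close>

lemma exists_word_of_len: "reach s h \<Longrightarrow> \<exists>w\<in>gwords V. int (length w) = len s \<and> cls w = h"
proof (induction rule: reach.induct)
  case reach_empty
  then show ?case by (intro bexI[of _ "[]"]) (auto simp: cls_Nil)
next
  case (reach_push s h v e)
  then obtain w where w: "w \<in> gwords V" "int (length w) = len s" "cls w = h" by blast
  define p where "p = (if e \<le> int N - e then replicate (nat e) (v, True)
    else replicate (nat (int N - e)) (v, False))"
  have p: "p \<in> gwords V" using reach_push by (simp add: p_def)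
  have "cls p = gen v [^]\<^bsub>H\<^esub> e"
  proof (cases "e \<le> int N - e")
    case True
    then show ?thesis using reach_push by (simp add: p_def cls_replicate flip: int_pow_int)
  next
    case False
    then have "cls p = gen v [^]\<^bsub>H\<^esub> (e - int N)"
      using reach_push by (simp add: p_def cls_replicate_False)
    also have "\<dots> = gen v [^]\<^bsub>H\<^esub> ((e - int N) mod int N)"
      using reach_push by (simp only: gen_pow_mod)
    also have "(e - int N) mod int N = e" using reach_push by simp
    finally show ?thesis .
  qed
  moreover have "int (length p) = weight e"
    using reach_push by (auto simp: p_def weight_eq)
  ultimately show ?case
    using w p reach_push by (intro bexI[of _ "p @ w"]) (auto simp: cls_append len_push)
qed

definition geod :: "'a gword \<Rightarrow> bool" where
  "geod w \<longleftrightarrow> w \<in> gwords V \<and> len (pile w) = int (length w)"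

abbreviation S where "S \<equiv> ngp_S \<Gamma> (\<lambda>_. N)"

section \<open>Letters as elements of the generating set\<close>

definition letter :: "'a \<times> bool \<Rightarrow> 'a gword set" where
  "letter a = cls [a]"

lemma letter_image: "letter ` (V \<times> UNIV) = S"
proof -
  have "letter (v, True) = gen v" if "v \<in> V" for v
    by (simp add: letter_def ngp_gen_def)
  moreover have "letter (v, False) = inv\<^bsub>H\<^esub> gen v" if "v \<in> V" for v
    using that by (simp add: letter_def inv_gen)
  moreover have "V \<times> (UNIV :: bool set) = (\<lambda>v. (v, True)) ` V \<union> (\<lambda>v. (v, False)) ` V"
    by (auto simp: image_iff)
  ultimately show ?thesis
    by (simp add: ngp_S_def image_Un image_image cong: image_cong)
qed

lemma lexp_mod_neq: "lexp b mod int N \<noteq> 0"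
proof
  assume "lexp b mod int N = 0"
  then have "weight (lexp b) = 0" using weight_mod[of "lexp b"] by simp
  moreover have "weight 1 = 1" using N_ge3 by (simp add: weight_eq)
  ultimately show False by (simp add: lexp_def weight_def min.commute split: if_splits)
qed

text \<open>Allows words over \<open>V \<times> UNIV\<close> to be counted instead of words over the
  set \<open>S\<close> of group elements. Distinct letters already act differently on the empty
  pile.\<close>

lemma inj_letter: "inj_on letter (V \<times> UNIV)"
proof (rule inj_onI)
  fix x y assume "x \<in> V \<times> (UNIV :: bool set)" "y \<in> V \<times> (UNIV :: bool set)" and eq: "letter x = letter y"
  then obtain u a v b where xy: "x = (u, a)" "y = (v, b)" "u \<in> V" "v \<in> V" by blast
  have "pres_eq V (ngp_rels \<Gamma> (\<lambda>_. N)) [(u, a)] [(v, b)]"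
    using eq xy by (simp add: letter_def pres_class_eq_iff)
  from run_cong[OF this valid_empty]
  have *: "act u (lexp a) (\<lambda>_. []) = act v (lexp b) (\<lambda>_. [])" by simp
  have t: "top (act u (lexp a) (\<lambda>_. [])) u = lexp a mod int N" "top (act v (lexp b) (\<lambda>_. [])) v = lexp b mod int N"
    using xy by (simp_all add: top_act valid_empty) (simp_all add: top_def)
  have "u = v"
  proof (rule ccontr)
    assume "u \<noteq> v"
    then have "top (act v (lexp b) (\<lambda>_. [])) u = 0"
      using lexp_mod_neq[of b] t(2) top_nonadj[OF valid_act[OF valid_empty xy(4)] xy(4)]
        top_act_adj[OF valid_empty] by (cases "(v, u) \<in> E") (auto simp: top_def)
    then show False using t(1) * lexp_mod_neq[of a] by simp
  qed
  moreover have "a = b"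
  proof (rule ccontr)
    assume "a \<noteq> b"
    then have "(1::int) mod int N = - 1 mod int N"
      using t * \<open>u = v\<close> by (auto simp: lexp_def split: if_splits)
    \<comment> \<open>For \<open>N = 2\<close> a generator would coincide with its inverse.\<close>
    then show False using N_ge3 by (simp add: zmod_zminus1_eq_if)
  qed
  ultimately show "x = y" using xy by simp
qed

lemma letters_image: "map letter ` gwords V = lists S"
  by (simp only: letter_image flip: lists_image)

lemma inj_letters: "inj_on (map letter) (gwords V)"
  using inj_letter by (simp add: inj_on_map_lists)

lemma word_val_letters: "w \<in> gwords V \<Longrightarrow> word_val H (map letter w) = cls w"
proof (induction w)
  case (Cons a w)
  then show ?case using cls_append[of "[a]" w] by (simp add: word_val_def letter_def)
qed (simp add: word_val_def cls_Nil)

lemma pile_cls_cong: "cls w = cls w' \<Longrightarrow> w \<in> gwords V \<Longrightarrow> pile w = pile w'"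
  by (simp add: pres_class_eq_iff run_cong valid_empty)

text \<open>The size of its pile is the word length of an element: words for the same element have
  the same pile, none is shorter than its size by \<open>len_run_le\<close>, and one attains it by
  \<open>exists_word_of_len\<close>.\<close>

lemma geodesic_letters:
  assumes w: "w \<in> gwords V"
  shows "geodesic H S (map letter w) \<longleftrightarrow> geod w"
proof
  assume g: "geodesic H S (map letter w)"
  have "reach (pile w) (cls w)"
    using reach_run[OF reach_empty w] cls_carrier[OF w] by simp
  from exists_word_of_len[OF this] obtain w' where w': "w' \<in> gwords V"
    "int (length w') = len (pile w)" "cls w' = cls w" by blast
  have "map letter w' \<in> lists S" using w' letters_image by blast
  then have "length w \<le> length w'"
    using g word_val_letters[OF w] word_val_letters[OF w'(1)] w'(3) unfolding geodesic_def
    by (metis length_map not_le_imp_less)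
  then show "geod w" using w w' len_run_le[OF valid_empty w] by (simp add: geod_def)
next
  assume g: "geod w"
  show "geodesic H S (map letter w)"
    unfolding geodesic_def
  proof (intro conjI notI)
    show "map letter w \<in> lists S" using w letters_image by blast
    assume "\<exists>x\<in>lists S. length x < length (map letter w) \<and> word_val H x = word_val H (map letter w)"
    then obtain w' where w': "w' \<in> gwords V" "length w' < length w" "cls w' = cls w"
      using w by (auto simp: letters_image[symmetric] word_val_letters)
    then have "len (pile w) \<le> int (length w')"
      using pile_cls_cong len_run_le[OF valid_empty w'(1)] by simp
    then show False using g w' by (simp add: geod_def)
  qed
qed

definition cont :: "'a gword \<Rightarrow> int fps" where
  "cont p = Abs_fps (\<lambda>m. int (card {x \<in> gwords V. length x = m \<and> geod (p @ x)}))"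

lemma geodesic_cont_letters:
  assumes p: "p \<in> gwords V"
  shows "geodesic_cont H S (map letter p) = cont p"
proof -
  have "card {x \<in> lists S. length x = m \<and> geodesic H S (map letter p @ x)}
      = card {x \<in> gwords V. length x = m \<and> geod (p @ x)}" for m
  proof -
    have *: "geodesic H S (map letter p @ map letter x) \<longleftrightarrow> geod (p @ x)" if "x \<in> gwords V" for x
    proof -
      have "p @ x \<in> gwords V" using p that by (simp only: append_in_lists_conv)
      from geodesic_letters[OF this] show ?thesis by simp
    qed
    have "{x \<in> lists S. length x = m \<and> geodesic H S (map letter p @ x)}
      = map letter ` {x \<in> gwords V. length (map letter x) = m \<and> geodesic H S (map letter p @ map letter x)}"
      unfolding letters_image[symmetric] by blast
    also have "{x \<in> gwords V. length (map letter x) = m \<and> geodesic H S (map letter p @ map letter x)}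
      = {x \<in> gwords V. length x = m \<and> geod (p @ x)}"
      by (intro Collect_cong conj_cong refl *) simp_all
    finally have "{x \<in> lists S. length x = m \<and> geodesic H S (map letter p @ x)}
      = map letter ` {x \<in> gwords V. length x = m \<and> geod (p @ x)}" .
    then show ?thesis
      using card_image[OF inj_on_subset[OF inj_letters]] by auto
  qed
  then show ?thesis by (simp add: geodesic_cont_def cont_def)
qed

section \<open>Continuations of a geodesic\<close>

lemma cont_eqI:
  assumes "\<And>x. x \<in> gwords V \<Longrightarrow> geod (p @ x) \<longleftrightarrow> geod (q @ x)"
  shows "cont p = cont q"
  unfolding cont_def using assms by (simp cong: conj_cong)

lemma cont_eq_0I:
  assumes "\<And>x. x \<in> gwords V \<Longrightarrow> \<not> geod (p @ x)"
  shows "cont p = 0"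
proof -
  have "{x \<in> gwords V. length x = m \<and> geod (p @ x)} = {}" for m
    using assms by blast
  then show ?thesis by (simp only: cont_def card.empty) (simp add: fps_eq_iff)
qed

lemma finite_gwords_length: "finite {x \<in> gwords V. length x = m \<and> P x}"
proof -
  have "finite {x. set x \<subseteq> V \<times> (UNIV :: bool set) \<and> length x = m}"
    using finite_V by (intro finite_lists_length_eq) simp
  then show ?thesis by (rule rev_finite_subset) auto
qed

text \<open>The constant coefficient records the empty continuation; any other continuation is split
  after its first letter.\<close>

lemma cont_rec: "cont p = of_bool (geod p) + fps_X * (\<Sum>a\<in>V \<times> UNIV. cont (p @ [a]))"
proof (rule fps_ext)
  fix m
  show "fps_nth (cont p) m = fps_nth (of_bool (geod p) + fps_X * (\<Sum>a\<in>V \<times> UNIV. cont (p @ [a]))) m"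
  proof (cases m)
    case 0
    have "{x \<in> gwords V. length x = 0 \<and> geod (p @ x)} = (if geod p then {[]} else {})" by auto
    then show ?thesis using 0 by (simp add: cont_def)
  next
    case (Suc j)
    let ?C = "\<lambda>a. {x \<in> gwords V. length x = j \<and> geod ((p @ [a]) @ x)}"
    have "{x \<in> gwords V. length x = Suc j \<and> geod (p @ x)} = (\<Union>a\<in>V \<times> UNIV. (#) a ` ?C a)"
    proof (intro equalityI subsetI)
      fix x assume "x \<in> {x \<in> gwords V. length x = Suc j \<and> geod (p @ x)}"
      then show "x \<in> (\<Union>a\<in>V \<times> UNIV. (#) a ` ?C a)" by (cases x) force+
    qed auto
    then have "card {x \<in> gwords V. length x = Suc j \<and> geod (p @ x)}
        = (\<Sum>a\<in>V \<times> UNIV. card ((#) a ` ?C a))"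
      using finite_V by (simp only:) (intro card_UN_disjoint, auto intro: finite_gwords_length)
    also have "\<dots> = (\<Sum>a\<in>V \<times> UNIV. card (?C a))"
      by (intro sum.cong refl card_image) simp
    finally show ?thesis
      using Suc by (simp add: cont_def fps_sum_nth)
  qed
qed

text \<open>The letters of \<open>p\<close> add at most \<open>length p\<close> to the size, so the
  pile of \<open>y\<close> must already have size \<open>length y\<close>.\<close>

lemma geod_appendD: "geod (p @ y) \<Longrightarrow> geod y"
proof -
  assume g: "geod (p @ y)"
  then have w: "p \<in> gwords V" "y \<in> gwords V" by (auto simp: geod_def)
  have "len (pile (p @ y)) \<le> int (length p) + len (pile y)"
    using len_run_le[OF valid_run[OF valid_empty w(2)] w(1)] by simp
  then show ?thesis
    using g w len_run_le[OF valid_empty w(2)] by (simp add: geod_def)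
qed

lemma geod_le_length:
  assumes "geod w" "w' \<in> gwords V" "pile w = pile w'"
  shows "length w \<le> length w'"
  using assms len_run_le[OF valid_empty assms(2)] by (simp add: geod_def)

section \<open>Prepending powers of a vertex\<close>

abbreviation vpow :: "'a \<Rightarrow> nat \<Rightarrow> 'a gword" where
  "vpow v k \<equiv> replicate k (v, True)"

lemma vpow_append: "v \<in> V \<Longrightarrow> vpow v k @ y \<in> gwords V \<longleftrightarrow> y \<in> gwords V"
  using gwords_replicate[of v k True] by (simp only: append_in_lists_conv simp_thms)

lemma run_replicate_False:
  "valid s \<Longrightarrow> v \<in> V \<Longrightarrow> run (replicate k (v, False)) s = act v (- int k) s"
  by (induction k) (simp_all add: act_dvd act_add lexp_def algebra_simps)

lemma pile_vpow: "y \<in> gwords V \<Longrightarrow> v \<in> V \<Longrightarrow> pile (vpow v k @ y) = act v (int k) (pile y)"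
  by (simp add: run_replicate valid_run valid_empty)

text \<open>If the letter cancelled the syllable on which it acts, the size of the pile would not
  increase.\<close>

lemma top_geod_Cons:
  assumes "geod ((u, b) # y)"
  shows "top (pile ((u, b) # y)) u \<noteq> 0"
proof
  assume t: "top (pile ((u, b) # y)) u = 0"
  have y: "u \<in> V" "y \<in> gwords V" "geod y"
    using assms geod_appendD[of "[(u, b)]" y] by (auto simp: geod_def)
  have v: "valid (pile y)" using y valid_run valid_empty by blast
  have "(top (pile y) u + lexp b) mod int N = 0" using t top_act[OF v y(1)] by simp
  then have "weight (top (pile y) u + lexp b) = 0" by (metis weight_0 weight_mod)
  then have "len (pile ((u, b) # y)) \<le> len (pile y)"
    using len_act[OF v y(1), of "lexp b"] weight_nonneg[of "top (pile y) u"] by simp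
  then show False using assms y by (simp add: geod_def)
qed

text \<open>Since \<open>v\<close> has no movable syllable, \<open>vpow v k\<close> becomes a new
  one, whose weight is \<open>k\<close> because \<open>k \<le> N div 2\<close>.\<close>

lemma geod_vpow_append:
  assumes "y \<in> gwords V" "v \<in> V" "k \<le> N div 2" "geod y \<Longrightarrow> top (pile y) v = 0"
  shows "geod (vpow v k @ y) \<longleftrightarrow> geod y"
proof
  assume y: "geod y"
  have "len (pile (vpow v k @ y)) = len (pile y) + int k"
    using len_act[OF valid_run[OF valid_empty assms(1)] assms(2), of "int k"] assms(4)[OF y]
    by (simp add: pile_vpow[OF assms(1,2)] weight_small[OF assms(3)] del: run_append)
  then show "geod (vpow v k @ y)"
    using y assms by (simp add: geod_def vpow_append del: run_append)
qed (rule geod_appendD)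

lemma top_nonadj_Cons:
  assumes "geod ((u, b) # y)" "u \<noteq> v" "(u, v) \<notin> E"
  shows "top (pile ((u, b) # y)) v = 0"
proof -
  have "u \<in> V" "(u, b) # y \<in> gwords V" using assms by (auto simp: geod_def)
  then show ?thesis
    using top_nonadj[OF valid_run[OF valid_empty] _ top_geod_Cons[OF assms(1)]] assms by auto
qed

lemma geod_drop:
  assumes "y \<in> gwords V" "u \<in> V" "v \<in> V" "u \<noteq> v" "(u, v) \<notin> E" "k \<le> N div 2"
  shows "geod (vpow v k @ (u, b) # y) \<longleftrightarrow> geod ((u, b) # y)"
  using assms by (intro geod_vpow_append top_nonadj_Cons) auto

text \<open>The letter \<open>w\<close> blocks \<open>v\<close>, and the power of \<open>u\<close>
  in between leaves the top of the stack of \<open>v\<close> unchanged because \<open>u\<close> and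
  \<open>v\<close> are adjacent.\<close>

lemma geod_drop_middle:
  assumes "y \<in> gwords V" "w \<in> V" "(u, v) \<in> E" "w \<noteq> v" "(w, v) \<notin> E" "k \<le> N div 2" "l \<le> N div 2"
  shows "geod (vpow v l @ vpow u k @ (w, b) # y) \<longleftrightarrow> geod (vpow u k @ (w, b) # y)"
proof (rule geod_vpow_append)
  have uv: "u \<in> V" "v \<in> V" using E_V assms by auto
  have w: "(w, b) # y \<in> gwords V" using assms by simp
  show "vpow u k @ (w, b) # y \<in> gwords V" using w uv by (simp only: vpow_append)
  assume "geod (vpow u k @ (w, b) # y)"
  then have "top (pile ((w, b) # y)) v = 0"
    using assms geod_appendD by (blast intro: top_nonadj_Cons)
  then show "top (pile (vpow u k @ (w, b) # y)) v = 0"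
    unfolding pile_vpow[OF w uv(1)]
    using top_act_adj[OF valid_run[OF valid_empty w] assms(3)] by simp
qed (use assms E_V in auto)

lemma geod_commute:
  assumes "(u, v) \<in> E" "y \<in> gwords V"
  shows "geod (vpow u k @ vpow v l @ y) \<longleftrightarrow> geod (vpow v l @ vpow u k @ y)"
proof -
  have uv: "u \<in> V" "v \<in> V" using E_V assms by auto
  have "valid (pile y)" using assms valid_run valid_empty by blast
  then have "pile (vpow u k @ vpow v l @ y) = pile (vpow v l @ vpow u k @ y)"
    using uv assms vpow_append[OF uv(1), of k y] vpow_append[OF uv(2), of l y]
      act_commute[of "pile y" u v] by (simp only: pile_vpow)
  then show ?thesis
    unfolding geod_def vpow_append[OF uv(1)] vpow_append[OF uv(2)]
    by (simp add: add.left_commute del: run_append)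
qed

lemma geod_vpow: "v \<in> V \<Longrightarrow> k \<le> N div 2 \<Longrightarrow> geod (vpow v k)"
  using geod_vpow_append[of "[]" v k] by (simp add: geod_def top_def)

lemma geod_vpow_vpow: "(u, v) \<in> E \<Longrightarrow> k \<le> N div 2 \<Longrightarrow> l \<le> N div 2 \<Longrightarrow> geod (vpow u k @ vpow v l)"
proof -
  assume *: "(u, v) \<in> E" "k \<le> N div 2" "l \<le> N div 2"
  then have uv: "u \<in> V" "v \<in> V" "(v, u) \<in> E" using E_V E_sym by auto
  have "top (pile (vpow v l)) u = 0"
    using pile_vpow[of "[]" v l] top_act_adj[OF valid_empty uv(3)] uv by (simp add: top_def)
  then show ?thesis
    using geod_vpow_append[of "vpow v l" u k] * uv geod_vpow by simp
qed

text \<open>Makes the series with exponent \<open>N div 2 + 1\<close> vanish, in accordance with the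
  convention.\<close>

lemma not_geod_vpow_Suc:
  assumes "v \<in> V" "y \<in> gwords V"
  shows "\<not> geod (vpow v (N div 2 + 1) @ y)"
proof
  assume g: "geod (vpow v (N div 2 + 1) @ y)"
  \<comment> \<open>\<open>v\<^bsup>K+1\<^esup>\<close> equals a power of the inverse of \<open>v\<close> with exponent at most \<open>K\<close>\<close>
  let ?j = "N - (N div 2 + 1)"
  have v: "valid (pile y)" using assms valid_run valid_empty by blast
  \<comment> \<open>Acting by \<open>- int N\<close> is trivial, and \<open>- int ?j\<close> is
    \<open>int (N div 2 + 1) - int N\<close>.\<close>
  have "act v (- int ?j) (pile y) = act v (int (N div 2 + 1)) (act v (- int N) (pile y))"
    using N_ge3 by (simp add: act_add[OF v assms(1)] of_nat_diff)
  then have "pile (vpow v (N div 2 + 1) @ y) = pile (replicate ?j (v, False) @ y)"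
    using v assms pile_vpow[OF assms(2,1), of "N div 2 + 1"] run_replicate_False[OF v assms(1), of ?j]
    by (simp add: act_dvd del: replicate_Suc)
  moreover have "replicate ?j (v, False) @ y \<in> gwords V"
    using assms gwords_replicate by (simp only: append_in_lists_conv)
  ultimately have "length (vpow v (N div 2 + 1) @ y) \<le> length (replicate ?j (v, False) @ y)"
    by (intro geod_le_length[OF g])
  \<comment> \<open>This is impossible, since \<open>2 * (N div 2 + 1)\<close> exceeds
    \<open>N\<close>.\<close>
  then have "N div 2 + 1 \<le> ?j" by simp
  then show False by linarith
qed

lemma not_geod_cancel:
  assumes "v \<in> V" "y \<in> gwords V" "k \<ge> 1"
  shows "\<not> geod (vpow v k @ (v, False) # y)"
proof
  assume g: "geod (vpow v k @ (v, False) # y)"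
  have v: "valid (pile y)" using assms valid_run valid_empty by blast
  have "pile (vpow v k @ (v, False) # y) = act v (int k) (act v (-1) (pile y))"
    using assms by (subst pile_vpow) (auto simp: lexp_def)
  also have "\<dots> = pile (vpow v (k - 1) @ y)"
    using assms v by (simp add: act_add pile_vpow of_nat_diff del: run_append)
  finally have "k + 1 \<le> k - 1"
    using geod_le_length[OF g, of "vpow v (k - 1) @ y"] assms vpow_append[of v "k - 1" y] by simp
  then show False by simp
qed

text \<open>
  Inverting the letters of a single vertex maps geodesics to geodesics; this identifies the
  continuations after a generator with those after its inverse.
\<close>

definition flip_letter :: "'a \<Rightarrow> 'a \<times> bool \<Rightarrow> 'a \<times> bool" where
  "flip_letter w a = (fst a, if fst a = w then \<not> snd a else snd a)"

text \<open>Markers stay \<open>0\<close> under negation, and the reduction keeps exponents in the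
  range that reachable piles use.\<close>

definition flip_pile :: "'a \<Rightarrow> ('a \<Rightarrow> int list) \<Rightarrow> 'a \<Rightarrow> int list" where
  "flip_pile w s = s(w := map (\<lambda>e. - e mod int N) (s w))"

lemma flip_letter_flip [simp]: "flip_letter w (flip_letter w a) = a"
  by (simp add: flip_letter_def prod_eq_iff)

lemma len_flip_pile: "len (flip_pile w s) = len s"
  by (auto simp: len_def flip_pile_def o_def intro!: sum.cong)

lemma top_flip_pile: "top (flip_pile w s) v = (if v = w then - top s v mod int N else top s v)"
  by (auto simp: top_def flip_pile_def split: list.split)

lemma flip_pile_push:
  assumes "0 \<le> e" "e < int N"
  shows "flip_pile w (push v e s) = push v (if v = w then - e mod int N else e) (flip_pile w s)"
proof -
  \<comment> \<open>A syllable is trivial iff its negative is, so both pushes leave the same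
    markers.\<close>
  have "- e mod int N = 0 \<longleftrightarrow> e = 0" using assms by (auto simp: zmod_zminus1_eq_if)
  then show ?thesis by (auto simp: push_def flip_pile_def fun_eq_iff)
qed

lemma flip_pile_act:
  assumes "valid s" "v \<in> V"
  shows "flip_pile w (act v d s) = act v (if v = w then - d else d) (flip_pile w s)"
proof -
  obtain s' where s': "top s' v = 0" "s = push v (top s v) s'" "0 \<le> top s v" "top s v < int N"
    using valid_decompose[OF assms] by metis
  define t where "t = top s v"
  have s: "s = push v t s'" using s' t_def by simp
  have t: "0 \<le> t" "t < int N" using s' t_def by auto
  have "flip_pile w (act v d s) = flip_pile w (push v ((t + d) mod int N) s')"
    using s by (simp add: act_push s'(1))
  also have "\<dots> = push v (if v = w then - (t + d) mod int N else (t + d) mod int N) (flip_pile w s')"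
    using N_ge3 by (subst flip_pile_push) (auto simp: mod_minus_eq)
  also have "\<dots> = act v (if v = w then - d else d)
      (push v (if v = w then - t mod int N else t) (flip_pile w s'))"
    using s'(1) by (subst act_push) (auto simp: top_flip_pile mod_diff_left_eq)
  also have "\<dots> = act v (if v = w then - d else d) (flip_pile w s)"
    using flip_pile_push[OF t] s by simp
  finally show ?thesis .
qed

lemma pile_flip: "x \<in> gwords V \<Longrightarrow> pile (map (flip_letter w) x) = flip_pile w (pile x)"
proof (induction x)
  case Nil
  then show ?case by (simp add: flip_pile_def)
next
  case (Cons a x)
  obtain v b where a: "a = (v, b)" "v \<in> V" using Cons by (cases a) auto
  have "valid (pile x)" using Cons valid_run valid_empty by simp
  then show ?case
    using Cons a by (auto simp: flip_letter_def flip_pile_act lexp_def)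
qed

lemma gwords_flip: "map (flip_letter w) x \<in> gwords V \<longleftrightarrow> x \<in> gwords V"
  by (induction x) (auto simp: flip_letter_def mem_Times_iff)

lemma geod_flip: "geod (map (flip_letter w) x) \<longleftrightarrow> geod x"
  using pile_flip[of x w] by (simp only: geod_def gwords_flip length_map) (metis len_flip_pile)

text \<open>Flipping the continuation as well is a length-preserving involution on words that
  matches the two sets being counted.\<close>

lemma cont_flip: "cont (map (flip_letter w) p) = cont p"
proof -
  let ?f = "map (flip_letter w)"
  have ff: "?f (?f x) = x" for x by (simp add: o_def)
  have g: "geod (?f p @ ?f x) \<longleftrightarrow> geod (p @ x)" for x
    using geod_flip[of w "p @ x"] by simp
  have g': "geod (?f p @ x) \<longleftrightarrow> geod (p @ ?f x)" for x
    using g[of "?f x"] by (simp only: ff)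
  have "bij_betw ?f {x \<in> gwords V. length x = m \<and> geod (?f p @ x)} {x \<in> gwords V. length x = m \<and> geod (p @ x)}"
    for m
    by (rule bij_betw_byWitness[where f' = ?f])
      (simp_all only: ff g g' gwords_flip length_map mem_Collect_eq image_subset_iff Ball_def simp_thms)
  from bij_betw_same_card[OF this] show ?thesis unfolding cont_def by (simp only:)
qed

text \<open>As \<open>w\<close> does not occur in \<open>p\<close>, flipping its letters fixes
  \<open>p\<close> and inverts only the appended letter.\<close>

lemma cont_snoc_bool:
  assumes "w \<notin> fst ` set p"
  shows "cont (p @ [(w, b)]) = cont (p @ [(w, True)])"
proof (cases b)
  case False
  have "map (flip_letter w) p = map (\<lambda>x. x) p"
    using assms by (intro map_cong) (auto simp: flip_letter_def)
  then have "map (flip_letter w) (p @ [(w, True)]) = p @ [(w, b)]"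
    using False by (simp add: flip_letter_def)
  then show ?thesis using cont_flip by metis
qed simp

section \<open>Summation over the graph\<close>

definition cont1 :: "'a \<Rightarrow> int fps" where
  "cont1 u = cont [(u, True)]"

definition cont2 :: "nat \<Rightarrow> 'a \<Rightarrow> 'a \<Rightarrow> int fps" where
  "cont2 k u w = cont (vpow u k @ [(w, True)])"

text \<open>A series-valued indicator turns sums over edges into double sums over \<open>V\<close>,
  whose order can be exchanged.\<close>

definition adj :: "'a \<Rightarrow> 'a \<Rightarrow> int fps" where
  "adj u v = of_bool ((u, v) \<in> E)"

lemma adj_sym: "adj u v = adj v u"
  using E_sym by (auto simp: adj_def)

lemma sum_letters: "(\<Sum>a\<in>V \<times> UNIV. f a) = (\<Sum>u\<in>V. f (u, True) + f (u, False))"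
proof -
  have "(\<Sum>a\<in>V \<times> UNIV. f a) = (\<Sum>u\<in>V. \<Sum>b\<in>UNIV. f (u, b))"
    by (simp add: sum.cartesian_product)
  then show ?thesis by (simp add: UNIV_bool add.commute)
qed

section \<open>Recursions by the next letter\<close>

lemma cont_vpow_snoc_nonadj:
  assumes "v \<in> V" "u \<in> V" "u \<noteq> v" "(v, u) \<notin> E" "k \<le> N div 2"
  shows "cont (vpow v k @ [(u, b)]) = cont1 u"
proof -
  have "cont (vpow v k @ [(u, b)]) = cont [(u, b)]"
    using assms E_sym[of u v] geod_drop[of _ u v k b] by (intro cont_eqI) (simp, blast)
  then show ?thesis using cont_snoc_bool[of u "[]" b] by (simp add: cont1_def)
qed

text \<open>The next letter \<open>v\<close> lengthens the power and its inverse is impossible; a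
  neighbour of \<open>v\<close> keeps the power relevant, and any other vertex blocks it. The
  factors \<open>2\<close> account for a letter and its inverse.\<close>

lemma cont_vpow_step:
  assumes "v \<in> V" "1 \<le> k" "k \<le> N div 2"
  shows "cont (vpow v k) = 1 + fps_X * (\<Sum>u\<in>V. of_bool (u = v) * cont (vpow v (k + 1))
    + adj v u * (2 * cont2 k v u) + (1 - of_bool (u = v) - adj v u) * (2 * cont1 u))"
proof -
  have "cont (vpow v k @ [(u, True)]) + cont (vpow v k @ [(u, False)]) =
      of_bool (u = v) * cont (vpow v (k + 1)) + adj v u * (2 * cont2 k v u)
      + (1 - of_bool (u = v) - adj v u) * (2 * cont1 u)" if "u \<in> V" for u
  proof (cases "u = v")
    case True
    have "cont (vpow v k @ [(v, False)]) = 0"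
      using not_geod_cancel assms by (intro cont_eq_0I) simp
    moreover have "vpow v k @ [(v, True)] = vpow v (k + 1)"
      by (simp add: replicate_append_same)
    ultimately show ?thesis using True by (simp only:) (simp add: adj_def)
  next
    case False
    then have "cont (vpow v k @ [(u, b)]) = cont2 k v u" for b
      unfolding cont2_def using cont_snoc_bool[of u "vpow v k" b] by auto
    then show ?thesis
      using False cont_vpow_snoc_nonadj[OF assms(1) that False _ assms(3)] by (auto simp: adj_def)
  qed
  then show ?thesis
    using cont_rec[of "vpow v k"] geod_vpow assms by (simp add: sum_letters)
qed

lemma cont_commute: "(u, v) \<in> E \<Longrightarrow> cont (vpow u k @ vpow v l @ p) = cont (vpow v l @ vpow u k @ p)"
  if "p \<in> gwords V"
proof (rule cont_eqI)
  fix x assume uv: "(u, v) \<in> E" and "x \<in> gwords V"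
  with that have "p @ x \<in> gwords V" by (simp only: append_in_lists_conv)
  from geod_commute[OF uv this] show "geod ((vpow u k @ vpow v l @ p) @ x) = geod ((vpow v l @ vpow u k @ p) @ x)"
    by (simp only: append_assoc)
qed

text \<open>Without triangles a vertex \<open>w\<close> is adjacent to at most one of
  \<open>u\<close> and \<open>v\<close>, so at most one of the two powers stays relevant after a
  letter other than these. Since \<open>u\<close> and \<open>v\<close> are adjacent to each other,
  \<open>1 - adj u w - adj v w\<close> vanishes at both, while the other two coefficients need
  explicit corrections there.\<close>

lemma cont_vpow2_step:
  assumes "triangle_free \<Gamma>" "(u, v) \<in> E" "1 \<le> k" "k \<le> N div 2" "1 \<le> l" "l \<le> N div 2"
  shows "cont (vpow u k @ vpow v l) = 1 + fps_X * (\<Sum>w\<in>V.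
    of_bool (w = u) * cont (vpow u (k + 1) @ vpow v l)
    + of_bool (w = v) * cont (vpow u k @ vpow v (l + 1))
    + (adj u w - of_bool (w = v)) * (2 * cont2 k u w)
    + (adj v w - of_bool (w = u)) * (2 * cont2 l v w)
    + (1 - adj u w - adj v w) * (2 * cont1 w))"
proof -
  have uv: "u \<in> V" "v \<in> V" "u \<noteq> v" "(v, u) \<in> E" using assms E_V E_neq E_sym by auto
  let ?p = "vpow u k @ vpow v l"
  have "cont (?p @ [(w, True)]) + cont (?p @ [(w, False)]) =
    of_bool (w = u) * cont (vpow u (k + 1) @ vpow v l)
    + of_bool (w = v) * cont (vpow u k @ vpow v (l + 1))
    + (adj u w - of_bool (w = v)) * (2 * cont2 k u w)
    + (adj v w - of_bool (w = u)) * (2 * cont2 l v w)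
    + (1 - adj u w - adj v w) * (2 * cont1 w)" if w: "w \<in> V" for w
  proof -
    \<comment> \<open>Moves the power of \<open>u\<close> next to the new letter, which serves the
      cases \<open>w = u\<close> and \<open>w\<close> adjacent to \<open>u\<close>.\<close>
    have comm: "cont (?p @ [(w, b)]) = cont (vpow v l @ vpow u k @ [(w, b)])" for b
      using cont_commute[of "[(w, b)]" u v k l] assms w by simp
    consider "w = u" | "w = v" | "w \<noteq> u" "w \<noteq> v" "(u, w) \<in> E" | "w \<noteq> u" "w \<noteq> v" "(v, w) \<in> E"
      | "w \<noteq> u" "w \<noteq> v" "(u, w) \<notin> E" "(v, w) \<notin> E" by blast
    then show ?thesis
    proof cases
      case 1
      have "cont (vpow v l @ vpow u k @ [(u, False)]) = 0"
      proof (rule cont_eq_0I)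
        fix x assume "x \<in> gwords V"
        then show "\<not> geod ((vpow v l @ vpow u k @ [(u, False)]) @ x)"
          using not_geod_cancel[of u x k] geod_appendD[of "vpow v l"] uv assms by auto
      qed
      moreover have "cont (vpow v l @ vpow u k @ [(u, True)]) = cont (vpow u (k + 1) @ vpow v l)"
        using cont_commute[of "[]" u v "k + 1" l] assms by (simp add: replicate_append_same)
      ultimately have "cont (?p @ [(w, True)]) + cont (?p @ [(w, False)]) = cont (vpow u (k + 1) @ vpow v l)"
        unfolding comm using 1 by simp
      then show ?thesis using 1 uv assms by (simp add: adj_def)
    next
      case 2
      have "cont (?p @ [(v, False)]) = 0"
      proof (rule cont_eq_0I)
        fix x assume "x \<in> gwords V"
        then show "\<not> geod ((?p @ [(v, False)]) @ x)"
          using not_geod_cancel[of v x l] geod_appendD[of "vpow u k"] uv assms by auto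
      qed
      moreover have "?p @ [(v, True)] = vpow u k @ vpow v (l + 1)"
        by (simp add: replicate_append_same)
      ultimately have "cont (?p @ [(w, True)]) + cont (?p @ [(w, False)]) = cont (vpow u k @ vpow v (l + 1))"
        using 2 by (simp only: add_0_right)
      then show ?thesis using 2 uv assms by (simp add: adj_def)
    next
      case 3
      then have n: "(v, w) \<notin> E" "(w, v) \<notin> E"
        using assms uv E_sym unfolding triangle_free_def by blast+
      have "cont (?p @ [(w, b)]) = cont2 k u w" for b
      proof -
        have "cont (?p @ [(w, b)]) = cont (vpow u k @ [(w, b)])"
          unfolding comm using 3 n w assms geod_drop_middle[of _ w u v k l b] by (intro cont_eqI) simp
        then show ?thesis
          unfolding cont2_def using 3 cont_snoc_bool[of w "vpow u k" b] by auto
      qed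
      then show ?thesis using 3 n by (simp add: adj_def)
    next
      case 4
      then have n: "(u, w) \<notin> E" "(w, u) \<notin> E"
        using assms uv E_sym unfolding triangle_free_def by blast+
      have "cont (?p @ [(w, b)]) = cont2 l v w" for b
      proof -
        have "cont (?p @ [(w, b)]) = cont (vpow v l @ [(w, b)])"
          using 4 n w uv assms geod_drop_middle[of _ w v u l k b] by (intro cont_eqI) simp
        then show ?thesis
          unfolding cont2_def using 4 cont_snoc_bool[of w "vpow v l" b] by auto
      qed
      then show ?thesis using 4 n by (simp add: adj_def)
    next
      \<comment> \<open>The letter blocks both vertices: first the power of \<open>u\<close> is
        dropped, then that of \<open>v\<close>.\<close>
      case 5
      then have n: "(w, u) \<notin> E" "(w, v) \<notin> E" using E_sym by blast+
      have "cont (?p @ [(w, b)]) = cont1 w" for b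
      proof -
        have "cont (?p @ [(w, b)]) = cont (vpow v l @ [(w, b)])"
        proof (rule cont_eqI)
          fix x assume x: "x \<in> gwords V"
          have y: "vpow v l @ (w, b) # x \<in> gwords V"
            using x w uv by (simp only: vpow_append) simp
          have "geod (vpow u k @ vpow v l @ (w, b) # x) \<longleftrightarrow> geod (vpow v l @ (w, b) # x)"
          proof (rule geod_vpow_append[OF y uv(1) assms(4)])
            assume "geod (vpow v l @ (w, b) # x)"
            then have "top (pile ((w, b) # x)) u = 0"
              using 5 n geod_appendD by (blast intro: top_nonadj_Cons)
            then show "top (pile (vpow v l @ (w, b) # x)) u = 0"
              using top_act_adj[OF valid_run[OF valid_empty, of "(w, b) # x"] uv(4)] w x uv
              by (subst pile_vpow) auto
          qed
          then show "geod ((?p @ [(w, b)]) @ x) = geod ((vpow v l @ [(w, b)]) @ x)" by simp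
        qed
        then show ?thesis using cont_vpow_snoc_nonadj 5 uv w assms by simp
      qed
      then show ?thesis using 5 by (simp add: adj_def)
    qed
  qed
  then show ?thesis
    using cont_rec[of ?p] geod_vpow_vpow[OF assms(2,4,6)] by (simp add: sum_letters)
qed

section \<open>The series of the theorem as sums over vertices\<close>

lemma letter_True: "map letter (vpow v k) = replicate k (gen v)"
  by (simp add: letter_def ngp_gen_def map_replicate)

text \<open>For \<open>k = N div 2 + 1\<close> both sides are zero, so the convention needs no
  separate treatment later.\<close>

lemma G1_eq: "G1 \<Gamma> N k = (\<Sum>v\<in>V. cont (vpow v k))"
  if "k \<le> N div 2 + 1"
proof -
  have "Delta1 \<Gamma> (\<lambda>_. N) v k = cont (vpow v k)" if "v \<in> V" for v
    using geodesic_cont_letters[of "vpow v k"] that gwords_replicate[of v k True]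
    by (simp add: Delta1_def letter_True del: map_replicate)
  moreover have "cont (vpow v (N div 2 + 1)) = 0" if "v \<in> V" for v
    using not_geod_vpow_Suc[OF that] by (intro cont_eq_0I) auto
  ultimately show ?thesis by (auto simp: G1_def)
qed

lemma sum_E: "(\<Sum>(u, v)\<in>E. f u v) = (\<Sum>u\<in>V. \<Sum>v\<in>V. adj u v * f u v)"
proof -
  have "(\<Sum>u\<in>V. \<Sum>v\<in>V. adj u v * f u v) = (\<Sum>(u, v)\<in>V \<times> V. of_bool ((u, v) \<in> E) * f u v)"
    by (simp add: sum.cartesian_product adj_def)
  also have "\<dots> = (\<Sum>(u, v)\<in>E. of_bool ((u, v) \<in> E) * f u v)"
    using E_V finite_V by (intro sum.mono_neutral_right) auto
  also have "\<dots> = (\<Sum>(u, v)\<in>E. f u v)" by (intro sum.cong) auto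
  finally show ?thesis by simp
qed

lemma G2_eq: "G2 \<Gamma> N k l = (\<Sum>u\<in>V. \<Sum>v\<in>V. adj u v * cont (vpow u k @ vpow v l))"
  if "k \<le> N div 2 + 1" "l \<le> N div 2 + 1"
proof -
  have "Delta2 \<Gamma> (\<lambda>_. N) u k v l = cont (vpow u k @ vpow v l)" if "(u, v) \<in> E" for u v
  proof -
    have "vpow u k @ vpow v l \<in> gwords V"
      using that E_V gwords_replicate by (auto simp only: append_in_lists_conv)
    from geodesic_cont_letters[OF this] show ?thesis
      by (simp add: Delta2_def letter_True del: map_replicate)
  qed
  moreover have "cont (vpow u k @ vpow v l) = 0" if "(u, v) \<in> E" "k = N div 2 + 1 \<or> l = N div 2 + 1" for u v
  proof (rule cont_eq_0I)
    fix x assume x: "x \<in> gwords V"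
    have uv: "u \<in> V" "v \<in> V" using that E_V by auto
    show "\<not> geod ((vpow u k @ vpow v l) @ x)"
      using that(2) not_geod_vpow_Suc[of v x] not_geod_vpow_Suc[of u "vpow v l @ x"] uv x
        geod_appendD[of "vpow u k" "vpow v l @ x"] vpow_append[of v l x] by (auto simp del: replicate_Suc)
  qed
  ultimately have "G2 \<Gamma> N k l = (\<Sum>(u, v)\<in>E. cont (vpow u k @ vpow v l))"
    unfolding G2_def by (auto intro!: sum.cong sum.neutral simp del: replicate_Suc)
  then show ?thesis by (simp only: sum_E)
qed

text \<open>A generator and its inverse have equally many continuations, which gives the factor
  \<open>2\<close>.\<close>

lemma growth_eq: "ngp_geodesic_growth \<Gamma> (\<lambda>_. N) = 2 * fps_X * G1 \<Gamma> N 1 + 1"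
proof -
  have "ngp_geodesic_growth \<Gamma> (\<lambda>_. N) = cont []"
    using geodesic_cont_letters[of "[]"]
    by (simp add: ngp_geodesic_growth_def geodesic_growth_def geodesic_cont_def)
  also have "\<dots> = 1 + fps_X * (\<Sum>u\<in>V. cont [(u, True)] + cont [(u, False)])"
    using cont_rec[of "[]"] by (simp add: sum_letters geod_def)
  also have "(\<Sum>u\<in>V. cont [(u, True)] + cont [(u, False)]) = (\<Sum>u\<in>V. 2 * cont [(u, True)])"
    using cont_snoc_bool[of _ "[]" False] by (intro sum.cong) simp_all
  finally show ?thesis
    using N_ge3 by (simp add: G1_eq algebra_simps flip: sum_distrib_left)
qed

lemma G1_1: "G1 \<Gamma> N 1 = (\<Sum>v\<in>V. cont1 v)"
  using N_ge3 by (simp add: G1_eq cont1_def)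

text \<open>By symmetry the exponent \<open>1\<close> may be put on the second vertex, the form in
  which the recursions produce it.\<close>

lemma G2_1: "1 \<le> k \<Longrightarrow> k \<le> N div 2 \<Longrightarrow> G2 \<Gamma> N 1 k = (\<Sum>u\<in>V. \<Sum>v\<in>V. adj u v * cont2 k u v)"
  using N_ge3 G2_commute[OF pair_graph, of N 1 k] by (simp add: G2_eq cont2_def)

lemma sum_of_bool_eq: "v \<in> V \<Longrightarrow> (\<Sum>u\<in>V. of_bool (u = v) * f u) = (f v :: int fps)"
  using finite_V by (simp add: of_bool_def if_distrib[of "\<lambda>x. x * _"] cong: if_cong)

section \<open>Counting in a regular graph\<close>

context
  fixes L :: nat
  assumes regular: "regular_graph \<Gamma> L"
begin

lemma sum_adj: "u \<in> V \<Longrightarrow> (\<Sum>v\<in>V. adj u v) = of_nat L"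
proof -
  assume u: "u \<in> V"
  have "(\<Sum>v\<in>V. adj u v) = of_nat (card (V \<inter> {v. (u, v) \<in> E}))"
    using finite_V by (simp add: adj_def)
  also have "V \<inter> {v. (u, v) \<in> E} = {v. (u, v) \<in> E}" using E_V by auto
  finally show ?thesis using regular u by (simp add: regular_graph_def)
qed

lemma sum_adj_fst: "(\<Sum>u\<in>V. \<Sum>v\<in>V. adj u v * f u) = of_nat L * (\<Sum>u\<in>V. f u)"
  by (simp add: sum_adj sum_distrib_left flip: sum_distrib_right)

lemma sum_adj_snd: "(\<Sum>u\<in>V. \<Sum>v\<in>V. adj u v * f v) = of_nat L * (\<Sum>u\<in>V. f u)"
  by (subst sum.swap) (simp add: adj_sym[of _ v for v] sum_adj_fst)

text \<open>A letter that blocks \<open>v\<close> comes from neither \<open>v\<close> nor its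
  \<open>L\<close> neighbours. Summed over \<open>v\<close>, these exclusions remove
  \<open>C\<close> and \<open>of_nat L * C\<close> from \<open>of_nat (card V) * C\<close>.\<close>

lemma G1_step:
  assumes "1 \<le> k" "k \<le> N div 2"
  shows "G1 \<Gamma> N k = fps_X * (G1 \<Gamma> N (k + 1) + 2 * G2 \<Gamma> N 1 k
      + 2 * (of_nat (card V) - of_nat L - 1) * G1 \<Gamma> N 1) + of_nat (card V)"
proof -
  define C where "C = (\<Sum>u\<in>V. cont1 u)"
  have row: "(\<Sum>u\<in>V. of_bool (u = v) * cont (vpow v (k + 1)) + adj v u * (2 * cont2 k v u)
      + (1 - of_bool (u = v) - adj v u) * (2 * cont1 u))
    = cont (vpow v (k + 1)) + 2 * (\<Sum>u\<in>V. adj v u * cont2 k v u)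
      + 2 * (C - cont1 v - (\<Sum>u\<in>V. adj v u * cont1 u))" if "v \<in> V" for v
  proof -
    have "(\<Sum>u\<in>V. of_bool (u = v) * cont (vpow v (k + 1)) + adj v u * (2 * cont2 k v u)
        + (1 - of_bool (u = v) - adj v u) * (2 * cont1 u))
      = (\<Sum>u\<in>V. of_bool (u = v) * cont (vpow v (k + 1)) + 2 * (adj v u * cont2 k v u)
        + 2 * (cont1 u - of_bool (u = v) * cont1 u - adj v u * cont1 u))"
      by (intro sum.cong refl) (simp add: algebra_simps)
    then show ?thesis
      by (simp only: sum.distrib sum_subtractf sum_of_bool_eq[OF that] C_def flip: sum_distrib_left)
  qed
  have "G1 \<Gamma> N k = (\<Sum>v\<in>V. 1 + fps_X * (cont (vpow v (k + 1)) + 2 * (\<Sum>u\<in>V. adj v u * cont2 k v u)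
      + 2 * (C - cont1 v - (\<Sum>u\<in>V. adj v u * cont1 u))))"
    using assms by (simp only: G1_eq cont_vpow_step row cong: sum.cong)
  also have "\<dots> = of_nat (card V) + fps_X * (G1 \<Gamma> N (k + 1) + 2 * G2 \<Gamma> N 1 k
      + 2 * (of_nat (card V) * C - C - of_nat L * C))"
    using assms unfolding G2_1[OF assms] C_def
    by (simp add: sum.distrib sum_subtractf sum_adj_snd G1_eq del: replicate_Suc
        flip: sum_distrib_left)
  finally show ?thesis unfolding G1_1 C_def by (simp add: algebra_simps)
qed

text \<open>Every \<open>u\<close> lies in \<open>L\<close> ordered adjacent pairs
  \<open>(u, v)\<close>, so \<open>R k u\<close> is counted \<open>L\<close> times, and the excluded
  terms \<open>cont2 k u v\<close> take away one copy: this is the factor \<open>L - 1\<close>.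
  Similarly \<open>C\<close> is counted once per ordered edge, while the \<open>D u\<close> and the
  \<open>D v\<close> each sum to \<open>of_nat L * (of_nat L * C)\<close>.\<close>

lemma G2_step:
  assumes "triangle_free \<Gamma>" "1 \<le> k" "k \<le> N div 2" "1 \<le> l" "l \<le> N div 2"
  shows "G2 \<Gamma> N k l = fps_X * (G2 \<Gamma> N (k + 1) l + G2 \<Gamma> N k (l + 1)
      + 2 * (of_nat L - 1) * (G2 \<Gamma> N 1 k + G2 \<Gamma> N 1 l)
      + 2 * of_nat L * (of_nat (card V) - 2 * of_nat L) * G1 \<Gamma> N 1) + of_nat (card V) * of_nat L"
proof -
  define C where "C = (\<Sum>u\<in>V. cont1 u)"
  define D where "D u = (\<Sum>w\<in>V. adj u w * cont1 w)" for u
  define R where "R k u = (\<Sum>w\<in>V. adj u w * cont2 k u w)" for k u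
  let ?A = "\<lambda>u v. cont (vpow u (k + 1) @ vpow v l)" and ?B = "\<lambda>u v. cont (vpow u k @ vpow v (l + 1))"
  have row: "(\<Sum>w\<in>V. of_bool (w = u) * ?A u v + of_bool (w = v) * ?B u v
      + (adj u w - of_bool (w = v)) * (2 * cont2 k u w) + (adj v w - of_bool (w = u)) * (2 * cont2 l v w)
      + (1 - adj u w - adj v w) * (2 * cont1 w))
    = ?A u v + ?B u v + 2 * (R k u - cont2 k u v) + 2 * (R l v - cont2 l v u) + 2 * (C - D u - D v)"
    if "u \<in> V" "v \<in> V" for u v
  proof -
    have "(\<Sum>w\<in>V. of_bool (w = u) * ?A u v + of_bool (w = v) * ?B u v
        + (adj u w - of_bool (w = v)) * (2 * cont2 k u w) + (adj v w - of_bool (w = u)) * (2 * cont2 l v w)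
        + (1 - adj u w - adj v w) * (2 * cont1 w))
      = (\<Sum>w\<in>V. of_bool (w = u) * ?A u v + of_bool (w = v) * ?B u v
        + 2 * (adj u w * cont2 k u w - of_bool (w = v) * cont2 k u w)
        + 2 * (adj v w * cont2 l v w - of_bool (w = u) * cont2 l v w)
        + 2 * (cont1 w - adj u w * cont1 w - adj v w * cont1 w))"
      by (intro sum.cong refl) (simp add: algebra_simps)
    then show ?thesis
      by (simp only: sum.distrib sum_subtractf sum_of_bool_eq that C_def D_def R_def flip: sum_distrib_left)
  qed
  have "G2 \<Gamma> N k l = (\<Sum>u\<in>V. \<Sum>v\<in>V. adj u v * (1 + fps_X * (?A u v + ?B u v + 2 * (R k u - cont2 k u v)
      + 2 * (R l v - cont2 l v u) + 2 * (C - D u - D v))))"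
  proof -
    \<comment> \<open>Off the edges the factor \<open>adj u v\<close> makes both sides vanish, so
      the recursion is only needed for adjacent pairs.\<close>
    have "adj u v * cont (vpow u k @ vpow v l) = adj u v * (1 + fps_X * (?A u v + ?B u v
        + 2 * (R k u - cont2 k u v) + 2 * (R l v - cont2 l v u) + 2 * (C - D u - D v)))"
      if "u \<in> V" "v \<in> V" for u v
      using cont_vpow2_step[OF assms(1) _ assms(2-5), of u v] row[OF that]
      by (cases "(u, v) \<in> E") (simp_all only: adj_def of_bool_eq mult_zero_left simp_thms)
    then show ?thesis using assms by (simp only: G2_eq trans_le_add1 cong: sum.cong)
  qed
  \<comment> \<open>The term \<open>cont2 l v u\<close> receives the factor \<open>adj v u\<close>,
    so that exchanging the sums turns it into \<open>G2 \<Gamma> N 1 l\<close>.\<close>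
  also have "\<dots> = (\<Sum>u\<in>V. \<Sum>v\<in>V. adj u v * 1 + fps_X * (adj u v * ?A u v + adj u v * ?B u v
      + 2 * (adj u v * R k u - adj u v * cont2 k u v) + 2 * (adj u v * R l v - adj v u * cont2 l v u)
      + 2 * (adj u v * C - adj u v * D u - adj u v * D v)))"
  proof (intro sum.cong refl)
    fix u v
    show "adj u v * (1 + fps_X * (?A u v + ?B u v + 2 * (R k u - cont2 k u v)
      + 2 * (R l v - cont2 l v u) + 2 * (C - D u - D v)))
      = adj u v * 1 + fps_X * (adj u v * ?A u v + adj u v * ?B u v
      + 2 * (adj u v * R k u - adj u v * cont2 k u v) + 2 * (adj u v * R l v - adj v u * cont2 l v u)
      + 2 * (adj u v * C - adj u v * D u - adj u v * D v))"
      unfolding adj_sym[of v u] by (simp add: algebra_simps del: replicate_Suc)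
  qed
  also have "\<dots> = of_nat L * of_nat (card V) + fps_X * (G2 \<Gamma> N (k + 1) l + G2 \<Gamma> N k (l + 1)
      + 2 * (of_nat L * G2 \<Gamma> N 1 k - G2 \<Gamma> N 1 k) + 2 * (of_nat L * G2 \<Gamma> N 1 l - G2 \<Gamma> N 1 l)
      + 2 * (of_nat L * (of_nat (card V) * C) - of_nat L * (of_nat L * C) - of_nat L * (of_nat L * C)))"
  proof -
    have "(\<Sum>u\<in>V. \<Sum>v\<in>V. adj v u * cont2 l v u) = G2 \<Gamma> N 1 l"
      unfolding G2_1[OF assms(4,5)] by (rule sum.swap)
    moreover have "(\<Sum>u\<in>V. R k u) = G2 \<Gamma> N 1 k" "(\<Sum>u\<in>V. R l u) = G2 \<Gamma> N 1 l"
      "(\<Sum>u\<in>V. D u) = of_nat L * C"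
      unfolding G2_1[OF assms(2,3)] G2_1[OF assms(4,5)]
      by (simp_all add: R_def D_def sum_adj_snd C_def)
    moreover have "(\<Sum>u\<in>V. \<Sum>v\<in>V. adj u v * 1) = of_nat L * of_nat (card V)"
      "(\<Sum>u\<in>V. \<Sum>v\<in>V. adj u v * C) = of_nat L * (of_nat (card V) * C)"
      using sum_adj_fst[of "\<lambda>_. 1"] sum_adj_fst[of "\<lambda>_. C"] by simp_all
    moreover have "G2 \<Gamma> N (k + 1) l = (\<Sum>u\<in>V. \<Sum>v\<in>V. adj u v * ?A u v)"
      "G2 \<Gamma> N k (l + 1) = (\<Sum>u\<in>V. \<Sum>v\<in>V. adj u v * ?B u v)"
      using assms by (simp_all only: G2_eq trans_le_add1 add_le_mono1)
    moreover note G2_1[OF assms(2,3)]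
    ultimately show ?thesis
      by (simp only: sum.distrib sum_subtractf sum_adj_fst sum_adj_snd flip: sum_distrib_left)
  qed
  finally show ?thesis unfolding G1_1 C_def by (simp add: algebra_simps)
qed

end

end

theorem theorem7p1:
  fixes \<Gamma> :: "'a pair_pre_digraph" and L n N K k l :: nat
  assumes "pair_graph \<Gamma>"
    and "regular_graph \<Gamma> L"
    and "triangle_free \<Gamma>"
    and "n = card (pverts \<Gamma>)"
    and "N \<ge> 3"
    and "K = N div 2"
    and "1 \<le> k" "k \<le> K"
    and "1 \<le> l" "l \<le> K"
  shows "ngp_geodesic_growth \<Gamma> (\<lambda>_. N) = 2 * fps_X * G1 \<Gamma> N 1 + 1
    \<and> G1 \<Gamma> N k =
           fps_X * (G1 \<Gamma> N (k + 1) + 2 * G2 \<Gamma> N 1 k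
                    + 2 * (of_nat n - of_nat L - 1) * G1 \<Gamma> N 1)
           + of_nat n
    \<and> G2 \<Gamma> N k l =
           fps_X * (G2 \<Gamma> N (k + 1) l + G2 \<Gamma> N k (l + 1)
                    + 2 * (of_nat L - 1) * (G2 \<Gamma> N 1 k + G2 \<Gamma> N 1 l)
                    + 2 * of_nat L * (of_nat n - 2 * of_nat L) * G1 \<Gamma> N 1)
           + of_nat n * of_nat L"
proof -
  interpret const_ngp \<Gamma> N
    by (rule const_ngp.intro) fact+
  show ?thesis
    using growth_eq G1_step[OF assms(2)] G2_step[OF assms(2,3)] assms(4-10) by blast
qed

end
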